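(* Let $G$ be a connected chordal graph, $\mathcal C$ its set of maximal cliques and $\mathcal S$ its set of minimal vertex separators. The clique tree of $G$ is unique if and only if both of the following hold: (i) $|\mathcal S|=|\mathcal C|-1$, i.e. $\nu(S)=1$ for all $S\in\mathcal S$; (ii) no two distinct minimal vertex separators of $G$ are in an inclusion relation (there are no $S,S'\in\mathcal S$ with $S\subset S'$ properly).
   Context: Graphs are finite, simple and undirected. Maximal cliques are regarded as subsets of the vertex set $V$; $\mathcal C=\{C_1,\dots,C_K\}$. A minimal vertex separator of $G$ is a set $S\subset V$ such that, for some pair of non-adjacent vertices $a,b$, $S$ separates $a$ from $b$ in $G$ and no proper subset of $S$ does. A clique tree of $G$ is a tree $T=(\mathcal C,\mathcal E)$ with node set $\mathcal C$ such that for all $C_1,C_2\in\mathcal C$ and every $C_3\in\mathcal C$ on the unique path in $T$ between $C_1$ and $C_2$, $C_1\cap C_2\subseteq C_3$. For a permutation $\pi$ of $\{1,\dots,K\}$ put $S_{\pi(k)}=(C_{\pi(1)}\cup\cdots\cup C_{\pi(k-1)})\cap C_{\pi(k)}$ for $k=2,\dots,K$. The sequence $C_{\pi(1)},\dots,C_{\pi(K)}$ is a perfect sequence if for all $k\ge2$ the set $S_{\pi(k)}$ is a clique and there exists $k'<k$ with $S_{\pi(k)}\subset C_{\pi(k')}$. It is known that for a perfect sequence $\{S_{\pi(2)},\dots,S_{\pi(K)}\}=\mathcal S$ (with possible repetitions on the left); the multiplicity of $S\in\mathcal S$ is $\nu(S)=\#\{k\in\{2,\dots,K\}\mid S_{\pi(k)}=S\}$,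 which is known not to depend on the perfect sequence $\pi$. *)

theory Defs
  imports "Graph_Theory.Graph_Theory"
begin

text \<open>
  A finite simple undirected graph is a \<^locale>\<open>pair_graph\<close>: a finite vertex set with a
  symmetric irreflexive set of ordered pairs; the edge between u and v is present as both
  (u, v) and (v, u).
\<close>

text \<open>
  In a \<^locale>\<open>pair_graph\<close>, traversing one edge back and forth counts as a directed
  \<^const>\<open>pre_digraph.cycle\<close> of length 2, so the predicates \<^const>\<open>forest\<close> and
  \<^const>\<open>tree\<close> from the library are not the undirected notions.  The cycles of the
  undirected graph are exactly the directed cycles of length at least 3.
\<close>

definition undirected_tree :: "'v pair_pre_digraph \<Rightarrow> bool" where
  "undirected_tree T \<longleftrightarrow> pair_graph T \<and> connected (with_proj T) \<and>
     \<not> (\<exists>p. pre_digraph.cycle (with_proj T) p \<and> 3 \<le> length p)"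

text \<open>A chord joins two vertices of the cycle without being an edge of it.\<close>

definition chordal :: "'v pair_pre_digraph \<Rightarrow> bool" where
  "chordal G \<longleftrightarrow>
     (\<forall>p. pre_digraph.cycle (with_proj G) p \<and> 4 \<le> length p \<longrightarrow>
       (\<exists>u \<in> fst ` set p. \<exists>v \<in> fst ` set p.
          (u, v) \<in> parcs G \<and> (u, v) \<notin> set p \<and> (v, u) \<notin> set p))"

definition clique :: "'v pair_pre_digraph \<Rightarrow> 'v set \<Rightarrow> bool" where
  "clique G C \<longleftrightarrow> C \<subseteq> pverts G \<and> (\<forall>u\<in>C. \<forall>v\<in>C. u \<noteq> v \<longrightarrow> (u, v) \<in> parcs G)"

definition max_cliques :: "'v pair_pre_digraph \<Rightarrow> 'v set set" where
  "max_cliques G = {C. clique G C \<and> \<not> (\<exists>D. clique G D \<and> C \<subset> D)}"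

definition separates :: "'v pair_pre_digraph \<Rightarrow> 'v set \<Rightarrow> 'v \<Rightarrow> 'v \<Rightarrow> bool" where
  "separates G S a b \<longleftrightarrow> S \<subseteq> pverts G - {a, b} \<and>
     (\<forall>p. pre_digraph.apath (with_proj G) a p b \<longrightarrow>
        set (pre_digraph.awalk_verts (with_proj G) a p) \<inter> S \<noteq> {})"

definition min_separators :: "'v pair_pre_digraph \<Rightarrow> 'v set set" where
  "min_separators G =
     {S. \<exists>a \<in> pverts G. \<exists>b \<in> pverts G. a \<noteq> b \<and> (a, b) \<notin> parcs G \<and>
        separates G S a b \<and> (\<forall>S'. S' \<subset> S \<longrightarrow> \<not> separates G S' a b)}"

definition clique_tree :: "'v pair_pre_digraph \<Rightarrow> 'v set pair_pre_digraph \<Rightarrow> bool" where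
  "clique_tree G T \<longleftrightarrow> undirected_tree T \<and> pverts T = max_cliques G \<and>
     (\<forall>C1 \<in> max_cliques G. \<forall>C2 \<in> max_cliques G. \<forall>p.
        pre_digraph.apath (with_proj T) C1 p C2 \<longrightarrow>
          (\<forall>C3 \<in> set (pre_digraph.awalk_verts (with_proj T) C1 p). C1 \<inter> C2 \<subseteq> C3))"

text \<open>
  An ordering of the maximal cliques is a duplicate-free list of them.  List positions start
  at 0, so the index range \<open>2, \<dots>, K\<close> becomes \<open>{1..<length Cs}\<close>.
\<close>

definition history_sep :: "'v set list \<Rightarrow> nat \<Rightarrow> 'v set" where
  "history_sep Cs k = (\<Union>j<k. Cs ! j) \<inter> Cs ! k"

definition perfect_sequence :: "'v pair_pre_digraph \<Rightarrow> 'v set list \<Rightarrow> bool" where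
  "perfect_sequence G Cs \<longleftrightarrow> distinct Cs \<and> set Cs = max_cliques G \<and>
     (\<forall>k \<in> {1..<length Cs}. clique G (history_sep Cs k) \<and>
        (\<exists>j<k. history_sep Cs k \<subseteq> Cs ! j))"

text \<open>
  The multiplicity \<open>\<nu>(S)\<close> computed along the perfect sequence \<open>Cs\<close>; for a chordal graph it
  does not depend on the choice of \<open>Cs\<close>.
\<close>

definition sep_multiplicity :: "'v set list \<Rightarrow> 'v set \<Rightarrow> nat" where
  "sep_multiplicity Cs S = card {k \<in> {1..<length Cs}. history_sep Cs k = S}"

end

theory Submission
  imports Defs
begin

text \<open>
  A clique tree is encoded as a symmetric relation \<open>R\<close> on the maximal cliques in which every edge
  is a bridge, and in which two cliques on different sides of an edge \<open>AB\<close> meet inside \<open>A \<inter> B\<close>.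
  For every such tree the minimal separators are exactly the intersections \<open>A \<inter> B\<close> along its
  edges.  Since a chordal graph has a simplicial vertex (Dirac), it has a perfect sequence, and a
  perfect sequence is a clique tree grown leaf by leaf, the \<open>k\<close>-th leaf being attached along
  \<open>S\<^bsub>\<pi>(k)\<^esub>\<close>.

  If two distinct edges \<open>AB\<close> and \<open>CD\<close> satisfy \<open>A \<inter> B \<subseteq> C \<inter> D\<close>, with \<open>CD\<close> on the side of \<open>B\<close>,
  then \<open>AB\<close> can be replaced by \<open>AC\<close> or \<open>AD\<close>, which gives a second clique tree.  Conversely, if
  the separators along the edges of \<open>R\<close> are distinct and form an antichain, then an edge \<open>XY\<close> of
  another clique tree is an edge of \<open>R\<close>: otherwise the first and the last edge of the path from
  \<open>X\<close> to \<open>Y\<close> in \<open>R\<close> would both carry a separator containing \<open>X \<inter> Y\<close>, hence equal to it.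
\<close>

section \<open>Junction trees\<close>

definition del_edge :: "'a rel \<Rightarrow> 'a \<Rightarrow> 'a \<Rightarrow> 'a rel" where
  "del_edge R A B = R - {(A, B), (B, A)}"

text \<open>Reachability after deletion takes the place of paths, so that both conjuncts can be
  treated by induction on closures.\<close>

definition junction_edge :: "'a set set \<Rightarrow> 'a set rel \<Rightarrow> 'a set \<Rightarrow> 'a set \<Rightarrow> bool" where
  "junction_edge N R A B \<longleftrightarrow> (A, B) \<notin> (del_edge R A B)\<^sup>* \<and>
     (\<forall>X\<in>N. \<forall>Y\<in>N. (X, A) \<in> (del_edge R A B)\<^sup>* \<longrightarrow> (Y, B) \<in> (del_edge R A B)\<^sup>* \<longrightarrow> X \<inter> Y \<subseteq> A \<inter> B)"

definition junction_tree :: "'a set set \<Rightarrow> 'a set rel \<Rightarrow> bool" where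
  "junction_tree N R \<longleftrightarrow> R \<subseteq> N \<times> N \<and> sym R \<and> (\<forall>A\<in>N. \<forall>B\<in>N. (A, B) \<in> R\<^sup>*) \<and>
     (\<forall>(A, B)\<in>R. junction_edge N R A B)"

section \<open>Reachability after deleting an edge\<close>

lemma del_edge_commute: "del_edge R A B = del_edge R B A"
  by (auto simp: del_edge_def)

lemma sym_del_edge: "sym R \<Longrightarrow> sym (del_edge R A B)"
  by (auto simp: del_edge_def sym_def)

lemma sym_rtranclD: "sym R \<Longrightarrow> (x, y) \<in> R\<^sup>* \<Longrightarrow> (y, x) \<in> R\<^sup>*"
  by (meson sym_rtrancl symD)

text \<open>An edge may go to a walk, in particular to a trivial one, so that the rule covers maps
  that collapse part of a tree.\<close>

lemma rtrancl_map_into: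
  assumes "(x, y) \<in> Q\<^sup>*" and "\<And>p q. (p, q) \<in> Q \<Longrightarrow> (h p, h q) \<in> P\<^sup>*"
  shows "(h x, h y) \<in> P\<^sup>*"
  using assms(1) by induction (auto intro: rtrancl_trans assms(2))

text \<open>The last exit is taken, not the first: the rest of the walk stays outside
  \<open>U\<close>, so it cannot use the edge \<open>(x, z)\<close> in either direction.\<close>

lemma rtrancl_last_exit:
  assumes "(w, y) \<in> R\<^sup>*" and "w \<in> U" and "y \<notin> U"
  shows "\<exists>x z. x \<in> U \<and> z \<notin> U \<and> (x, z) \<in> R \<and> (z, y) \<in> (R \<inter> (- U) \<times> (- U))\<^sup>*"
proof -
  \<comment> \<open>Strengthened for the induction from the left: the walk either lies outside
    \<open>U\<close> so far or already shows its last exit.\<close>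
  have "(w \<notin> U \<and> (w, y) \<in> (R \<inter> (- U) \<times> (- U))\<^sup>*) \<or>
      (\<exists>x z. x \<in> U \<and> z \<notin> U \<and> (x, z) \<in> R \<and> (z, y) \<in> (R \<inter> (- U) \<times> (- U))\<^sup>*)"
    using assms(1)
  proof (induction rule: converse_rtrancl_induct)
    case base
    then show ?case using assms(3) by simp
  next
    case (step p q)
    show ?case
    proof (cases "q \<notin> U \<and> (q, y) \<in> (R \<inter> (- U) \<times> (- U))\<^sup>*")
      case True
      show ?thesis
      proof (cases "p \<in> U")
        case False
        with True step(1) have "(p, q) \<in> R \<inter> (- U) \<times> (- U)" by auto
        with True False show ?thesis by (meson converse_rtrancl_into_rtrancl)
      qed (use True step(1) in blast)
    qed (use step.IH in blast)
  qed
  with assms(2) show ?thesis by blast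
qed

lemma junction_edge_commute:
  assumes "sym R"
  shows "junction_edge N R A B \<longleftrightarrow> junction_edge N R B A"
  unfolding junction_edge_def del_edge_commute[of R B A]
  using sym_rtranclD[OF sym_del_edge[OF assms]] by (metis Int_commute)

text \<open>A walk from \<open>X\<close> to \<open>A\<close>, cut off before its first use of the
  edge, ends in \<open>A\<close> or in \<open>B\<close>.\<close>

lemma junction_tree_side:
  assumes "junction_tree N R" and "(A, B) \<in> R" and "X \<in> N"
  shows "(X, A) \<in> (del_edge R A B)\<^sup>* \<or> (X, B) \<in> (del_edge R A B)\<^sup>*"
proof -
  have "(X, A) \<in> R\<^sup>*" using assms by (auto simp: junction_tree_def)
  then show ?thesis
  proof (induction rule: converse_rtrancl_induct)
    case (step p q)
    show ?case
    proof (cases "(p, q) \<in> del_edge R A B")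
      case True
      then show ?thesis using step.IH by (meson converse_rtrancl_into_rtrancl)
    next
      case False
      then show ?thesis using step(1) by (auto simp: del_edge_def)
    qed
  qed simp
qed

lemma junction_edge_neq: "junction_edge N R A B \<Longrightarrow> A \<noteq> B"
  by (auto simp: junction_edge_def)

text \<open>Collapsing everything outside \<open>S\<close> to \<open>P\<close> maps walks of the new tree to walks of the
  old one.\<close>

lemma junction_edge_attach:
  assumes "sym R" and edge: "junction_edge N R x y" and "x \<in> S" "y \<in> S" "P \<in> S" "P \<in> N" "Q \<notin> S"
    and closed: "\<And>p q. (p, q) \<in> R0 \<Longrightarrow> p \<in> S \<longleftrightarrow> q \<in> S"
    and R0: "\<And>p q. (p, q) \<in> R0 \<Longrightarrow> p \<in> S \<Longrightarrow> (p, q) \<in> R"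
    and N': "N' \<inter> S \<subseteq> N"
    and inter: "\<And>X Y. X \<in> N' \<Longrightarrow> X \<in> S \<Longrightarrow> Y \<in> N' \<Longrightarrow> Y \<notin> S \<Longrightarrow> X \<inter> Y \<subseteq> P"
  shows "junction_edge N' (R0 \<union> {(P, Q), (Q, P)}) x y"
proof -
  let ?R' = "R0 \<union> {(P, Q), (Q, P)}"
  define h where "h X = (if X \<in> S then X else P)" for X
  have h: "(h p, h q) \<in> (del_edge R x y)\<^sup>*" if "(p, q) \<in> (del_edge ?R' x y)\<^sup>*" for p q
    using that
  proof (rule rtrancl_map_into)
    fix p q assume "(p, q) \<in> del_edge ?R' x y"
    \<comment> \<open>An arc inside \<open>S\<close> survives in \<open>R\<close>; an arc outside
      \<open>S\<close> and the new arc between \<open>P\<close> and \<open>Q\<close> collapse to the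
      node \<open>P\<close>.\<close>
    then have "h p = h q \<or> (h p, h q) \<in> del_edge R x y"
      using closed R0 \<open>P \<in> S\<close> \<open>Q \<notin> S\<close> by (auto simp: h_def del_edge_def)
    then show "(h p, h q) \<in> (del_edge R x y)\<^sup>*" by auto
  qed
  have hxy: "h x = x" "h y = y" using \<open>x \<in> S\<close> \<open>y \<in> S\<close> by (auto simp: h_def)
  have hN: "h X \<in> N" if "X \<in> N'" for X using that N' \<open>P \<in> N\<close> by (auto simp: h_def)
  have not: "(x, y) \<notin> (del_edge R x y)\<^sup>*"
    and le: "\<And>X Y. X \<in> N \<Longrightarrow> Y \<in> N \<Longrightarrow> (X, x) \<in> (del_edge R x y)\<^sup>* \<Longrightarrow>
      (Y, y) \<in> (del_edge R x y)\<^sup>* \<Longrightarrow> X \<inter> Y \<subseteq> x \<inter> y"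
    using edge by (auto simp: junction_edge_def)
  show ?thesis unfolding junction_edge_def
  proof (intro conjI ballI impI)
    show "(x, y) \<notin> (del_edge ?R' x y)\<^sup>*" using h[of x y] not hxy by auto
  next
    fix X Y assume XY: "X \<in> N'" "Y \<in> N'"
      and p: "(X, x) \<in> (del_edge ?R' x y)\<^sup>*" "(Y, y) \<in> (del_edge ?R' x y)\<^sup>*"
    have hX: "h X \<inter> h Y \<subseteq> x \<inter> y"
      using le[OF hN[OF XY(1)] hN[OF XY(2)]] h[OF p(1)] h[OF p(2)] hxy by simp
    show "X \<inter> Y \<subseteq> x \<inter> y"
    proof (cases "X \<in> S \<or> Y \<in> S")
      case True
      then have "X \<inter> Y \<subseteq> h X \<inter> h Y"
        using inter[OF XY(1) _ XY(2)] inter[OF XY(2) _ XY(1)] by (auto simp: h_def)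
      with hX show ?thesis by blast
    next
      \<comment> \<open>Both cliques then collapse to \<open>P\<close>, which would be joined to
        both ends of the bridge from \<open>x\<close> to \<open>y\<close>.\<close>
      case False
      then have "(P, x) \<in> (del_edge R x y)\<^sup>*" "(P, y) \<in> (del_edge R x y)\<^sup>*"
        using h[OF p(1)] h[OF p(2)] hxy by (auto simp: h_def)
      then have "(x, y) \<in> (del_edge R x y)\<^sup>*"
        using sym_rtranclD[OF sym_del_edge[OF \<open>sym R\<close>]] by (meson rtrancl_trans)
      with not show ?thesis by blast
    qed
  qed
qed


section \<open>Growing and rearranging junction trees\<close>

lemma junction_tree_singleton: "junction_tree {C} {}"
  by (auto simp: junction_tree_def sym_def)

text \<open>For the old edges the leaf \<open>C\<close> is collapsed onto \<open>P\<close>. Deleting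
  the new edge leaves \<open>C\<close> isolated, and there \<open>sub\<close> is the junction
  condition.\<close>

lemma junction_tree_add_leaf:
  assumes T: "junction_tree N R" and "C \<notin> N" and "P \<in> N" and sub: "\<Union>N \<inter> C \<subseteq> P"
  shows "junction_tree (insert C N) (R \<union> {(P, C), (C, P)})"
proof -
  let ?N = "insert C N" and ?R = "R \<union> {(P, C), (C, P)}"
  have RN: "R \<subseteq> N \<times> N" and "sym R" and conn: "\<And>A B. A \<in> N \<Longrightarrow> B \<in> N \<Longrightarrow> (A, B) \<in> R\<^sup>*"
    and edge: "\<And>A B. (A, B) \<in> R \<Longrightarrow> junction_edge N R A B"
    using T by (auto simp: junction_tree_def)
  have "sym ?R" using \<open>sym R\<close> by (auto simp: sym_def)
  have toP: "(A, P) \<in> ?R\<^sup>*" if "A \<in> ?N" for A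
    using that conn[of A P] \<open>P \<in> N\<close> rtrancl_mono[of R ?R] by auto
  have old: "junction_edge ?N ?R A B" if "(A, B) \<in> R" for A B
    by (rule junction_edge_attach[OF \<open>sym R\<close> edge[OF that], where S = N and Q = C and P = P and ?R0.0 = R])
      (use that RN \<open>P \<in> N\<close> \<open>C \<notin> N\<close> sub in auto)
  have C: "A = B" if "(A, B) \<in> R\<^sup>*" "A = C \<or> B = C" for A B
    using that RN \<open>C \<notin> N\<close> by (auto elim: rtranclE converse_rtranclE)
  have del: "del_edge ?R P C = R" using RN \<open>C \<notin> N\<close> by (auto simp: del_edge_def)
  have new: "junction_edge ?N ?R P C"
    unfolding junction_edge_def del
    using C \<open>P \<in> N\<close> \<open>C \<notin> N\<close> sub by blast
  show ?thesis
    unfolding junction_tree_def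
  proof (intro conjI ballI)
    show "(A, B) \<in> ?R\<^sup>*" if "A \<in> ?N" "B \<in> ?N" for A B
      using toP[OF that(1)] sym_rtranclD[OF \<open>sym ?R\<close> toP[OF that(2)]] by (rule rtrancl_trans)
  qed (use RN \<open>P \<in> N\<close> \<open>sym ?R\<close> old new junction_edge_commute[OF \<open>sym ?R\<close>] in auto)
qed

text \<open>Deleting the edge from \<open>A\<close> to \<open>B\<close> leaves two sides, with
  \<open>D\<close> on that of \<open>B\<close>. Cliques from different sides meet inside
  \<open>A \<inter> B\<close>, hence inside \<open>D\<close>, so joining \<open>A\<close> to
  \<open>D\<close> restores a junction tree.\<close>

lemma junction_tree_move_edge:
  assumes T: "junction_tree N R" and AB: "(A, B) \<in> R" and "D \<in> N" and "D \<noteq> B"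
    and DB: "(D, B) \<in> (del_edge R A B)\<^sup>*" and sub: "A \<inter> B \<subseteq> D"
  shows "\<exists>R'. R' \<noteq> R \<and> junction_tree N R'"
proof -
  define R0 where "R0 = del_edge R A B"
  define R' where "R' = R0 \<union> {(A, D), (D, A)}"
  have RN: "R \<subseteq> N \<times> N" and "sym R" and conn: "\<And>A B. A \<in> N \<Longrightarrow> B \<in> N \<Longrightarrow> (A, B) \<in> R\<^sup>*"
    and edge: "\<And>A B. (A, B) \<in> R \<Longrightarrow> junction_edge N R A B"
    using T by (auto simp: junction_tree_def)
  have "A \<in> N" "B \<in> N" using AB RN by auto
  have R0R: "R0 \<subseteq> R" by (auto simp: R0_def del_edge_def)
  have "sym R0" unfolding R0_def using \<open>sym R\<close> by (rule sym_del_edge)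
  note sym0 = sym_rtranclD[OF this]
  have "sym R'" using \<open>sym R0\<close> by (auto simp: sym_def R'_def)
  have AB0: "(A, B) \<notin> R0\<^sup>*"
    and le: "\<And>X Y. X \<in> N \<Longrightarrow> Y \<in> N \<Longrightarrow> (X, A) \<in> R0\<^sup>* \<Longrightarrow> (Y, B) \<in> R0\<^sup>* \<Longrightarrow> X \<inter> Y \<subseteq> A \<inter> B"
    using edge[OF AB] by (auto simp: junction_edge_def R0_def)
  have DB0: "(D, B) \<in> R0\<^sup>*" using DB by (simp add: R0_def)
  have AD0: "(A, D) \<notin> R0\<^sup>*" using AB0 DB0 by (meson rtrancl_trans)
  have side: "(X, A) \<in> R0\<^sup>* \<or> (X, B) \<in> R0\<^sup>*" if "X \<in> N" for X
    using junction_tree_side[OF T AB that] by (simp add: R0_def)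
  have closed: "(p, Z) \<in> R0\<^sup>* \<longleftrightarrow> (q, Z) \<in> R0\<^sup>*" if "(p, q) \<in> R0" for p q Z
    using that \<open>sym R0\<close> by (meson converse_rtrancl_into_rtrancl symD)
  \<comment> \<open>An old edge stays within one side. The other side is collapsed, to
    \<open>A\<close> in the first case and to \<open>D\<close> in the second.\<close>
  have old: "junction_edge N R' x y" if "(x, y) \<in> R0" for x y
  proof (cases "(x, A) \<in> R0\<^sup>*")
    case True
    show ?thesis unfolding R'_def
    proof (rule junction_edge_attach[OF \<open>sym R\<close> edge, where S = "{X. (X, A) \<in> R0\<^sup>*}"])
      show "(x, y) \<in> R" using that R0R by auto
      show "x \<in> {X. (X, A) \<in> R0\<^sup>*}" "y \<in> {X. (X, A) \<in> R0\<^sup>*}"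
        using True closed[OF that, of A] by auto
      show "D \<notin> {X. (X, A) \<in> R0\<^sup>*}" using AD0 sym0 by auto
      show "X \<inter> Y \<subseteq> A" if "X \<in> N" "X \<in> {X. (X, A) \<in> R0\<^sup>*}" "Y \<in> N" "Y \<notin> {X. (X, A) \<in> R0\<^sup>*}" for X Y
        using le[of X Y] side[of Y] that by auto
    qed (use closed R0R \<open>A \<in> N\<close> in auto)
  next
    case False
    have "x \<in> N" using that R0R RN by auto
    with False have xB: "(x, B) \<in> R0\<^sup>*" using side by auto
    have "junction_edge N (R0 \<union> {(D, A), (A, D)}) x y"
    proof (rule junction_edge_attach[OF \<open>sym R\<close> edge, where S = "{X. (X, B) \<in> R0\<^sup>*}"])
      show "(x, y) \<in> R" using that R0R by auto
      show "x \<in> {X. (X, B) \<in> R0\<^sup>*}" "y \<in> {X. (X, B) \<in> R0\<^sup>*}"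
        using xB closed[OF that, of B] by auto
      show "X \<inter> Y \<subseteq> D" if "X \<in> N" "X \<in> {X. (X, B) \<in> R0\<^sup>*}" "Y \<in> N" "Y \<notin> {X. (X, B) \<in> R0\<^sup>*}" for X Y
        using le[of Y X] side[of Y] that sub by auto
    qed (use closed R0R \<open>D \<in> N\<close> DB0 AB0 in auto)
    then show ?thesis by (simp add: R'_def insert_commute)
  qed
  have "(A, D) \<notin> R0" using AD0 by auto
  moreover have "(D, A) \<notin> R0" using AD0 sym0 by auto
  ultimately have del: "del_edge R' A D = R0" by (auto simp: R'_def del_edge_def)
  have new: "junction_edge N R' A D"
    unfolding junction_edge_def del
  proof (intro conjI ballI impI)
    show "X \<inter> Y \<subseteq> A \<inter> D" if "X \<in> N" "Y \<in> N" "(X, A) \<in> R0\<^sup>*" "(Y, D) \<in> R0\<^sup>*" for X Y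
      using le[OF that(1,2,3) rtrancl_trans[OF that(4) DB0]] sub by auto
  qed (rule AD0)
  have toA: "(X, A) \<in> R'\<^sup>*" if "X \<in> N" for X
  proof -
    have mono: "R0\<^sup>* \<subseteq> R'\<^sup>*" by (rule rtrancl_mono) (auto simp: R'_def)
    have "(D, A) \<in> R'" by (simp add: R'_def)
    moreover have "(B, D) \<in> R'\<^sup>*" using sym0[OF DB0] mono by auto
    ultimately show ?thesis using side[OF that] mono
      by (meson rtrancl.rtrancl_into_rtrancl rtrancl_trans subsetD)
  qed
  have "junction_tree N R'"
    unfolding junction_tree_def
  proof (intro conjI ballI)
    show "(X, Y) \<in> R'\<^sup>*" if "X \<in> N" "Y \<in> N" for X Y
      using toA[OF that(1)] sym_rtranclD[OF \<open>sym R'\<close> toA[OF that(2)]] by (rule rtrancl_trans)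
    show "R' \<subseteq> N \<times> N" using R0R RN \<open>A \<in> N\<close> \<open>D \<in> N\<close> by (auto simp: R'_def)
    show "case e of (X, Y) \<Rightarrow> junction_edge N R' X Y" if "e \<in> R'" for e
    proof -
      obtain X Y where e: "e = (X, Y)" by (cases e)
      from that consider "(X, Y) \<in> R0" | "(X, Y) = (A, D)" | "(X, Y) = (D, A)"
        by (auto simp: R'_def e)
      then have "junction_edge N R' X Y"
        using old new junction_edge_commute[OF \<open>sym R'\<close>] by cases auto
      then show ?thesis by (simp add: e)
    qed
  qed (rule \<open>sym R'\<close>)
  \<comment> \<open>The pair \<open>(A, B)\<close> is gone: the deletion removed it, and the new
    edge leads from \<open>A\<close> to \<open>D \<noteq> B\<close>.\<close>
  moreover have "R' \<noteq> R"
  proof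
    assume "R' = R"
    with AB have "(A, B) \<in> R0 \<or> (A, B) = (A, D) \<or> (A, B) = (D, A)" by (auto simp: R'_def)
    then show False using AB0 \<open>D \<noteq> B\<close> junction_edge_neq[OF edge[OF AB]] by auto
  qed
  ultimately show ?thesis by blast
qed

lemma junction_tree_not_unique:
  assumes T: "junction_tree N R" and AB: "(A, B) \<in> R" and CD: "(C, D) \<in> R"
    and "{A, B} \<noteq> {C, D}" and sub: "A \<inter> B \<subseteq> C \<inter> D"
  shows "\<exists>R'. R' \<noteq> R \<and> junction_tree N R'"
proof -
  have RN: "R \<subseteq> N \<times> N" and "sym R" and edge: "\<And>A B. (A, B) \<in> R \<Longrightarrow> junction_edge N R A B"
    using T by (auto simp: junction_tree_def)
  have CD0: "(C, D) \<in> del_edge R A B" "(D, C) \<in> del_edge R A B"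
    using CD \<open>sym R\<close> \<open>{A, B} \<noteq> {C, D}\<close> by (auto simp: del_edge_def sym_def doubleton_eq_iff)
  have "C \<noteq> D" "C \<in> N" "D \<in> N" using junction_edge_neq[OF edge[OF CD]] CD RN by auto
  \<comment> \<open>\<open>A'\<close> and \<open>B'\<close> are \<open>A\<close> and
    \<open>B\<close> in the order that puts \<open>C\<close> on the side of \<open>B'\<close>. The
    edge has to move to a node other than \<open>B'\<close>, so \<open>D\<close> is taken when
    \<open>C = B'\<close>.\<close>
  have *: ?thesis if "(A', B') \<in> R" "(C, B') \<in> (del_edge R A' B')\<^sup>*"
    and eq: "del_edge R A' B' = del_edge R A B" "A' \<inter> B' = A \<inter> B" for A' B'
  proof (cases "C = B'")
    case True
    with CD0 have "(D, B') \<in> (del_edge R A' B')\<^sup>*" by (auto simp: eq)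
    then show ?thesis using junction_tree_move_edge[OF T that(1) \<open>D \<in> N\<close>] True \<open>C \<noteq> D\<close> sub eq by auto
  next
    case False
    then show ?thesis using junction_tree_move_edge[OF T that(1) \<open>C \<in> N\<close>] that sub by auto
  qed
  from junction_tree_side[OF T AB \<open>C \<in> N\<close>] show ?thesis
  proof
    assume "(C, A) \<in> (del_edge R A B)\<^sup>*"
    then show ?thesis using *[of B A] AB \<open>sym R\<close> by (auto simp: del_edge_commute sym_def)
  next
    assume "(C, B) \<in> (del_edge R A B)\<^sup>*"
    then show ?thesis using *[of A B] AB by auto
  qed
qed

text \<open>The witness is the neighbour of \<open>X\<close> on the way to \<open>Y\<close>:
  deleting that edge leaves \<open>Y\<close> on the side of \<open>Z\<close>. Applied from both
  ends, this gives the first and the last edge of the path between two cliques.\<close>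

lemma junction_tree_nonedge:
  assumes T: "junction_tree N R" and "X \<in> N" "Y \<in> N" "X \<noteq> Y"
  shows "\<exists>Z. (X, Z) \<in> R \<and> X \<inter> Y \<subseteq> X \<inter> Z"
proof -
  have edge: "\<And>A B. (A, B) \<in> R \<Longrightarrow> junction_edge N R A B" and "(X, Y) \<in> R\<^sup>*"
    using T assms by (auto simp: junction_tree_def)
  obtain Z where XZ: "(X, Z) \<in> R" "Z \<noteq> X" and ZY: "(Z, Y) \<in> (R \<inter> (- {X}) \<times> (- {X}))\<^sup>*"
    using rtrancl_last_exit[OF \<open>(X, Y) \<in> R\<^sup>*\<close>, of "{X}"] \<open>X \<noteq> Y\<close> by auto
  have "R \<inter> (- {X}) \<times> (- {X}) \<subseteq> del_edge R X Z" by (auto simp: del_edge_def)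
  from rtrancl_mono[OF this] ZY have "(Z, Y) \<in> (del_edge R X Z)\<^sup>*" by auto
  then have "(Y, Z) \<in> (del_edge R X Z)\<^sup>*"
    using T sym_rtranclD[OF sym_del_edge] by (auto simp: junction_tree_def)
  with edge[OF XZ(1)] have "X \<inter> Y \<subseteq> X \<inter> Z"
    using \<open>X \<in> N\<close> \<open>Y \<in> N\<close> by (auto simp: junction_edge_def)
  with XZ show ?thesis by blast
qed

lemma junction_tree_unique:
  assumes T: "junction_tree N R" and T': "junction_tree N R'"
    and M: "\<And>A B. (A, B) \<in> R \<union> R' \<Longrightarrow> A \<inter> B \<in> M"
    and anti: "\<And>S S'. S \<in> M \<Longrightarrow> S' \<in> M \<Longrightarrow> \<not> S \<subset> S'"
    and inj: "\<And>A B C D. (A, B) \<in> R \<Longrightarrow> (C, D) \<in> R \<Longrightarrow> A \<inter> B = C \<inter> D \<Longrightarrow> {A, B} = {C, D}"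
  shows "R' = R"
proof
  show sub: "R' \<subseteq> R"
  proof (rule ccontr)
    assume "\<not> R' \<subseteq> R"
    then obtain X Y where XY: "(X, Y) \<in> R'" "(X, Y) \<notin> R" by auto
    have "X \<in> N" "Y \<in> N" "X \<noteq> Y"
      using T' XY(1) junction_edge_neq[of N R' X Y] by (auto simp: junction_tree_def)
    then obtain Z W where Z: "(X, Z) \<in> R" "X \<inter> Y \<subseteq> X \<inter> Z" and W: "(Y, W) \<in> R" "Y \<inter> X \<subseteq> Y \<inter> W"
      using junction_tree_nonedge[OF T, of X Y] junction_tree_nonedge[OF T, of Y X] by auto
    have "X \<inter> Y = X \<inter> Z" "X \<inter> Y = Y \<inter> W"
      using anti[OF M M, of X Y X Z] anti[OF M M, of X Y Y W] XY Z W by blast+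
    \<comment> \<open>The antichain condition has turned both inclusions into equalities. Now the
      two edges coincide, and \<open>X \<noteq> Y\<close> leaves only \<open>Z = Y\<close>.\<close>
    then have "{X, Z} = {Y, W}" using inj Z(1) W(1) by metis
    with \<open>X \<noteq> Y\<close> Z(1) XY(2) show False by (auto simp: doubleton_eq_iff)
  qed
  show "R \<subseteq> R'"
  proof (rule ccontr)
    assume "\<not> R \<subseteq> R'"
    then obtain X Y where XY: "(X, Y) \<in> R" "(X, Y) \<notin> R'" by auto
    have "sym R'" using T' by (simp add: junction_tree_def)
    \<comment> \<open>If \<open>R'\<close> misses an edge of \<open>R\<close>, it lies inside
      \<open>R\<close> without a bridge, which contradicts its connectedness.\<close>
    then have "R' \<subseteq> del_edge R X Y" using sub XY by (auto simp: del_edge_def sym_def)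
    then have mono: "R'\<^sup>* \<subseteq> (del_edge R X Y)\<^sup>*" by (rule rtrancl_mono)
    have "X \<in> N" "Y \<in> N" using T XY(1) by (auto simp: junction_tree_def)
    then have "(X, Y) \<in> R'\<^sup>*" using T' by (auto simp: junction_tree_def)
    with mono have "(X, Y) \<in> (del_edge R X Y)\<^sup>*" by auto
    then show False using T XY(1) by (auto simp: junction_tree_def junction_edge_def)
  qed
qed

section \<open>Clique trees as junction trees\<close>

lemma pcas_append: "pcas u (p @ q) v \<longleftrightarrow> (\<exists>w. pcas u p w \<and> pcas w q v)"
  by (induction p arbitrary: u) auto

lemma pawalk_verts_append_Cons:
  "pcas u p x \<Longrightarrow> pawalk_verts u (p @ (x, y) # q) = pawalk_verts u p @ pawalk_verts y q"
  by (induction p arbitrary: u) auto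

lemma pawalk_verts_first: "pcas u p v \<Longrightarrow> u \<in> set (pawalk_verts u p)"
  by (cases p) auto

lemma pawalk_verts_last: "pcas u p v \<Longrightarrow> v \<in> set (pawalk_verts u p)"
  by (induction p arbitrary: u) auto

lemma set_pawalk_verts:
  "pcas u p v \<Longrightarrow> set (pawalk_verts u p) = insert u (snd ` set p)"
  by (induction p arbitrary: u) auto

lemma arc_in_pawalk_verts:
  "pcas u p v \<Longrightarrow> (x, y) \<in> set p \<Longrightarrow> x \<in> set (pawalk_verts u p) \<and> y \<in> set (pawalk_verts u p)"
  by (induction p arbitrary: u) (auto simp: set_pawalk_verts)

lemma pcas_rtrancl: "pcas u p v \<Longrightarrow> set p \<subseteq> Q \<Longrightarrow> (u, v) \<in> Q\<^sup>*"
  by (induction p arbitrary: u) (auto intro: converse_rtrancl_into_rtrancl)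

lemma pawalk_suffix:
  assumes "pcas w p v" and "u \<in> set (pawalk_verts w p)"
  shows "\<exists>q. set q \<subseteq> set p \<and> pcas u q v \<and> (distinct (pawalk_verts w p) \<longrightarrow> distinct (pawalk_verts u q))"
  using assms
proof (induction p arbitrary: w)
  case Nil
  then show ?case by (intro exI[of _ "[]"]) auto
next
  case (Cons e p)
  show ?case
  proof (cases "u = fst e")
    case True
    then show ?thesis using Cons.prems by (intro exI[of _ "e # p"]) auto
  next
    case False
    then obtain q where "set q \<subseteq> set p" "pcas u q v"
      "distinct (pawalk_verts (snd e) p) \<longrightarrow> distinct (pawalk_verts u q)"
      using Cons by auto
    then show ?thesis by (intro exI[of _ q]) auto
  qed
qed

text \<open>If the vertex to be prepended already occurs, the suffix starting there is used instead,
  which shortcuts the walk.\<close>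

lemma rtrancl_distinct_pawalk:
  "(u, v) \<in> Q\<^sup>* \<Longrightarrow> \<exists>p. set p \<subseteq> Q \<and> pcas u p v \<and> distinct (pawalk_verts u p)"
proof (induction rule: converse_rtrancl_induct)
  case base
  show ?case by (intro exI[of _ "[]"]) auto
next
  case (step u w)
  then obtain p where p: "set p \<subseteq> Q" "pcas w p v" "distinct (pawalk_verts w p)" by blast
  show ?case
  proof (cases "u \<in> set (pawalk_verts w p)")
    case True
    then show ?thesis using pawalk_suffix[OF p(2) True] p by (meson subset_trans)
  next
    case False
    then show ?thesis using p step(1) by (intro exI[of _ "(u, w) # p"]) auto
  qed
qed

lemma apath_pcas:
  "pre_digraph.apath (with_proj G) u p v \<longleftrightarrow>
     u \<in> pverts G \<and> set p \<subseteq> parcs G \<and> pcas u p v \<and> distinct (pawalk_verts u p)"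
  by (simp add: pre_digraph.apath_def pre_digraph.awalk_def cas_with_proj_eq awalk_verts_with_proj_eq)

lemma cycle_pcas:
  "pre_digraph.cycle (with_proj G) p \<longleftrightarrow>
     (\<exists>u \<in> pverts G. set p \<subseteq> parcs G \<and> pcas u p u \<and> distinct (tl (pawalk_verts u p)) \<and> p \<noteq> [])"
  by (auto simp: pre_digraph.cycle_def pre_digraph.awalk_def cas_with_proj_eq awalk_verts_with_proj_eq)

section \<open>Undirected trees as connected graphs whose edges are bridges\<close>

lemma pair_graph_iff:
  "pair_graph G \<longleftrightarrow> finite (pverts G) \<and> parcs G \<subseteq> pverts G \<times> pverts G \<and> sym (parcs G) \<and>
     (\<forall>u. (u, u) \<notin> parcs G)"
proof
  assume "pair_graph G"
  then interpret pair_graph G .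
  show "finite (pverts G) \<and> parcs G \<subseteq> pverts G \<times> pverts G \<and> sym (parcs G) \<and> (\<forall>u. (u, u) \<notin> parcs G)"
    using pair_finite_verts wellformed' pair_sym_arcs pair_no_loops[of "(u, u)" for u]
    by (auto simp: symmetric_def)
next
  assume G: "finite (pverts G) \<and> parcs G \<subseteq> pverts G \<times> pverts G \<and> sym (parcs G) \<and> (\<forall>u. (u, u) \<notin> parcs G)"
  then have "finite (parcs G)" by (meson finite_SigmaI finite_subset)
  with G show "pair_graph G"
    by unfold_locales (auto simp: symmetric_def)
qed

lemma connected_iff:
  assumes "pair_graph G"
  shows "connected (with_proj G) \<longleftrightarrow> pverts G \<noteq> {} \<and> (\<forall>u\<in>pverts G. \<forall>v\<in>pverts G. (u, v) \<in> (parcs G)\<^sup>*)"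
proof -
  interpret pair_graph G by fact
  have "symcl (parcs G) = parcs G"
    using assms by (auto simp: symcl_def pair_graph_iff sym_def)
  then have "connected (with_proj G) \<longleftrightarrow> pverts G \<noteq> {} \<and> (\<forall>u\<in>pverts G. \<forall>v\<in>pverts G. u \<rightarrow>\<^sup>*\<^bsub>with_proj G\<^esub> v)"
    by (simp add: connected_conv reachable_def)
  then show ?thesis by (auto simp: reachable_conv)
qed

text \<open>The rest of a long cycle joins the ends of its first arc without using that arc in
  either direction. Conversely, a path around an edge has at least two arcs and closes up with the
  edge.\<close>

lemma no_long_cycle_iff:
  assumes G: "pair_graph G"
  shows "(\<exists>p. pre_digraph.cycle (with_proj G) p \<and> 3 \<le> length p) \<longleftrightarrow>
    (\<exists>a b. (a, b) \<in> parcs G \<and> (a, b) \<in> (del_edge (parcs G) a b)\<^sup>*)" (is "?L \<longleftrightarrow> ?R")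
proof
  assume ?L
  then obtain u p where p: "set p \<subseteq> parcs G" "pcas u p u" "distinct (tl (pawalk_verts u p))" "3 \<le> length p"
    by (auto simp: cycle_pcas)
  then obtain b q where pq: "p = (u, b) # q" by (cases p) auto
  then have q: "pcas b q u" "distinct (pawalk_verts b q)" "2 \<le> length q" and ub: "(u, b) \<in> parcs G"
    and Q: "set q \<subseteq> parcs G"
    using p by auto
  \<comment> \<open>Length at least 3 enters here: \<open>q\<close> has two arcs or more, so
    \<open>r\<close> is nonempty.\<close>
  obtain c r where qr: "q = (b, c) # r" "r \<noteq> []" using q by (cases q; cases "tl q") auto
  have "(u, b) \<notin> set q" using q arc_in_pawalk_verts[of c r u u b] pawalk_verts_first[of c r u]
    by (auto simp: qr)
  moreover have "(b, u) \<notin> set q"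
  proof
    assume "(b, u) \<in> set q"
    with q arc_in_pawalk_verts[of c r u b u] have "c = u" by (auto simp: qr)
    \<comment> \<open>With \<open>c = u\<close> the nonempty walk \<open>r\<close> would return to
      \<open>u\<close>, although its vertices are distinct.\<close>
    with q qr show False using pawalk_verts_last[of _ "tl r" u] by (cases r) auto
  qed
  ultimately have "set q \<subseteq> del_edge (parcs G) b u" using Q by (auto simp: del_edge_def)
  from pcas_rtrancl[OF q(1) this] have "(b, u) \<in> (del_edge (parcs G) b u)\<^sup>*" .
  moreover have "(b, u) \<in> parcs G" using ub G by (auto simp: pair_graph_iff sym_def)
  ultimately show ?R by blast
next
  assume ?R
  then obtain a b where ab: "(a, b) \<in> parcs G" "(a, b) \<in> (del_edge (parcs G) a b)\<^sup>*" by blast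
  obtain p where p: "set p \<subseteq> del_edge (parcs G) a b" "pcas a p b" "distinct (pawalk_verts a p)"
    using rtrancl_distinct_pawalk[OF ab(2)] by blast
  have "a \<noteq> b" using ab(1) G by (auto simp: pair_graph_iff)
  with p have "2 \<le> length p" by (cases p; cases "tl p") (auto simp: del_edge_def)
  moreover have "(b, a) \<in> parcs G" "b \<in> pverts G"
    using ab(1) G by (auto simp: pair_graph_iff sym_def)
  ultimately have "pre_digraph.cycle (with_proj G) ((b, a) # p)" "3 \<le> length ((b, a) # p)"
    using p by (auto simp: cycle_pcas del_edge_def intro!: bexI[of _ b])
  then show ?L by blast
qed

lemma undirected_tree_iff:
  "undirected_tree T \<longleftrightarrow> pair_graph T \<and> pverts T \<noteq> {} \<and>
     (\<forall>u\<in>pverts T. \<forall>v\<in>pverts T. (u, v) \<in> (parcs T)\<^sup>*) \<and>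
     (\<forall>(a, b)\<in>parcs T. (a, b) \<notin> (del_edge (parcs T) a b)\<^sup>*)"
  unfolding undirected_tree_def using connected_iff[of T] no_long_cycle_iff[of T] by blast

text \<open>No vertex of a path repeats, so \<open>y\<close> does not occur before the arc, nor
  \<open>x\<close> after it. Both pieces therefore avoid the arc and its reverse.\<close>

lemma distinct_pawalk_split:
  assumes p: "pcas u (p @ (x, y) # q) v" "distinct (pawalk_verts u (p @ (x, y) # q))"
    and sub: "set (p @ (x, y) # q) \<subseteq> R"
  shows "(u, x) \<in> (del_edge R x y)\<^sup>*" and "(y, v) \<in> (del_edge R x y)\<^sup>*"
proof -
  have pq: "pcas u p x" "pcas y q v" using p(1) by (auto simp: pcas_append)
  have d: "distinct (pawalk_verts u p @ pawalk_verts y q)"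
    using p(2) pawalk_verts_append_Cons[OF pq(1)] by simp
  have "x \<in> set (pawalk_verts u p)" "y \<in> set (pawalk_verts y q)"
    using pq by (auto intro: pawalk_verts_first pawalk_verts_last)
  with d have "y \<notin> set (pawalk_verts u p)" "x \<notin> set (pawalk_verts y q)" by auto
  then have "(x, y) \<notin> set p" "(y, x) \<notin> set p" "(x, y) \<notin> set q" "(y, x) \<notin> set q"
    using arc_in_pawalk_verts[OF pq(1)] arc_in_pawalk_verts[OF pq(2)] by blast+
  then have "set p \<subseteq> del_edge R x y" "set q \<subseteq> del_edge R x y"
    using sub by (auto simp: del_edge_def)
  with pq show "(u, x) \<in> (del_edge R x y)\<^sup>*" and "(y, v) \<in> (del_edge R x y)\<^sup>*"
    by (auto intro: pcas_rtrancl)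
qed

text \<open>From paths to edges: paths from \<open>X\<close> to \<open>A\<close> and from
  \<open>B\<close> to \<open>Y\<close> join across the edge to one path through \<open>A\<close> and
  \<open>B\<close>. From edges to paths: a node \<open>Z \<noteq> X\<close> of a path is the head of
  an arc whose deletion leaves \<open>Y\<close> on the side of \<open>Z\<close>.\<close>

lemma junction_property_iff:
  assumes RN: "R \<subseteq> N \<times> N" and "sym R"
    and bridge: "\<And>A B. (A, B) \<in> R \<Longrightarrow> (A, B) \<notin> (del_edge R A B)\<^sup>*"
  shows "(\<forall>X\<in>N. \<forall>Y\<in>N. \<forall>p. set p \<subseteq> R \<and> pcas X p Y \<and> distinct (pawalk_verts X p) \<longrightarrow>
      (\<forall>Z\<in>set (pawalk_verts X p). X \<inter> Y \<subseteq> Z)) \<longleftrightarrow> (\<forall>(A, B)\<in>R. junction_edge N R A B)"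
    (is "?L \<longleftrightarrow> ?R")
proof
  assume L: ?L
  have "junction_edge N R A B" if AB: "(A, B) \<in> R" for A B
    unfolding junction_edge_def
  proof (intro conjI ballI impI)
    fix X Y assume XY: "X \<in> N" "Y \<in> N"
      and p: "(X, A) \<in> (del_edge R A B)\<^sup>*" "(Y, B) \<in> (del_edge R A B)\<^sup>*"
    let ?D = "del_edge R A B"
    have sD: "sym ?D" using \<open>sym R\<close> by (rule sym_del_edge)
    have BY: "(B, Y) \<in> ?D\<^sup>*" using sym_rtranclD[OF sD p(2)] .
    obtain r s where r: "set r \<subseteq> ?D" "pcas X r A" "distinct (pawalk_verts X r)"
      and s: "set s \<subseteq> ?D" "pcas B s Y" "distinct (pawalk_verts B s)"
      using rtrancl_distinct_pawalk[OF p(1)] rtrancl_distinct_pawalk[OF BY] by blast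
    \<comment> \<open>A common node would connect \<open>A\<close> with \<open>B\<close> around the
      bridge.\<close>
    have "set (pawalk_verts X r) \<inter> set (pawalk_verts B s) = {}"
    proof (rule ccontr)
      assume "\<not> ?thesis"
      then obtain Z where Z: "Z \<in> set (pawalk_verts X r)" "Z \<in> set (pawalk_verts B s)" by blast
      have "(Z, A) \<in> ?D\<^sup>*" using pawalk_suffix[OF r(2) Z(1)] r(1) pcas_rtrancl by (metis subset_trans)
      moreover have "(Z, Y) \<in> ?D\<^sup>*" using pawalk_suffix[OF s(2) Z(2)] s(1) pcas_rtrancl by (metis subset_trans)
      ultimately have "(A, B) \<in> ?D\<^sup>*" using p(2) sym_rtranclD[OF sD] by (meson rtrancl_trans)
      with bridge[OF AB] show False by blast
    qed
    then have "distinct (pawalk_verts X (r @ (A, B) # s))"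
      using r s by (simp add: pawalk_verts_append_Cons)
    moreover have "pcas X (r @ (A, B) # s) Y" using r s by (auto simp: pcas_append)
    moreover have "set (r @ (A, B) # s) \<subseteq> R" using r s AB by (auto simp: del_edge_def)
    ultimately have "\<forall>Z\<in>set (pawalk_verts X (r @ (A, B) # s)). X \<inter> Y \<subseteq> Z" using L XY by blast
    moreover have "A \<in> set (pawalk_verts X (r @ (A, B) # s))" "B \<in> set (pawalk_verts X (r @ (A, B) # s))"
      using r(2) s(2) pawalk_verts_append_Cons[OF r(2), of B s] pawalk_verts_last[OF r(2)]
        pawalk_verts_first[OF s(2)] by auto
    ultimately show "X \<inter> Y \<subseteq> A \<inter> B" by blast
  qed (rule bridge[OF AB])
  then show ?R by auto
next
  assume R: ?R
  show ?L
  proof (intro ballI allI impI)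
    fix X Y p Z
    assume XY: "X \<in> N" "Y \<in> N" and p: "set p \<subseteq> R \<and> pcas X p Y \<and> distinct (pawalk_verts X p)"
      and Z: "Z \<in> set (pawalk_verts X p)"
    show "X \<inter> Y \<subseteq> Z"
    proof (cases "Z = X")
      case False
      then have "Z \<in> snd ` set p" using Z p set_pawalk_verts[of X p Y] by simp
      then obtain A where "(A, Z) \<in> set p" by (metis imageE prod.collapse)
      then obtain r s where rs: "p = r @ (A, Z) # s" by (meson split_list)
      have "(X, A) \<in> (del_edge R A Z)\<^sup>*" "(Z, Y) \<in> (del_edge R A Z)\<^sup>*"
        using distinct_pawalk_split[of X r A Z s Y R] p unfolding rs by blast+
      moreover from this have "(Y, Z) \<in> (del_edge R A Z)\<^sup>*"
        using sym_rtranclD[OF sym_del_edge[OF \<open>sym R\<close>]] by blast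
      moreover have "junction_edge N R A Z" using R p \<open>(A, Z) \<in> set p\<close> by blast
      ultimately show ?thesis using XY unfolding junction_edge_def by blast
    qed simp
  qed
qed

lemma junction_tree_undirected_tree:
  assumes "finite (pverts T)" and "pverts T \<noteq> {}" and T: "junction_tree (pverts T) (parcs T)"
  shows "undirected_tree T"
proof -
  have edge: "\<And>A B. (A, B) \<in> parcs T \<Longrightarrow> junction_edge (pverts T) (parcs T) A B"
    using T by (auto simp: junction_tree_def)
  have "pair_graph T"
    unfolding pair_graph_iff using assms edge[THEN junction_edge_neq] by (auto simp: junction_tree_def)
  moreover have "\<forall>(A, B)\<in>parcs T. (A, B) \<notin> (del_edge (parcs T) A B)\<^sup>*"
    using edge unfolding junction_edge_def by blast
  moreover have "\<forall>A\<in>pverts T. \<forall>B\<in>pverts T. (A, B) \<in> (parcs T)\<^sup>*"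
    using T by (simp add: junction_tree_def)
  ultimately show ?thesis using assms(2) unfolding undirected_tree_iff by blast
qed

text \<open>The node set being fixed, a clique tree is determined by its arcs, so its uniqueness
  becomes uniqueness of a relation.\<close>

lemma clique_tree_iff:
  assumes "finite (max_cliques G)" and "max_cliques G \<noteq> {}"
  shows "clique_tree G T \<longleftrightarrow> pverts T = max_cliques G \<and> junction_tree (max_cliques G) (parcs T)"
proof (cases "pverts T = max_cliques G \<and> undirected_tree T")
  case True
  then have 1: "pverts T = max_cliques G" and T: "pair_graph T"
    "\<forall>u\<in>max_cliques G. \<forall>v\<in>max_cliques G. (u, v) \<in> (parcs T)\<^sup>*"
    "\<And>a b. (a, b) \<in> parcs T \<Longrightarrow> (a, b) \<notin> (del_edge (parcs T) a b)\<^sup>*"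
    unfolding undirected_tree_iff by auto
  then have R: "parcs T \<subseteq> max_cliques G \<times> max_cliques G" "sym (parcs T)"
    unfolding pair_graph_iff by auto
  have "clique_tree G T \<longleftrightarrow> (\<forall>X\<in>max_cliques G. \<forall>Y\<in>max_cliques G. \<forall>p.
      set p \<subseteq> parcs T \<and> pcas X p Y \<and> distinct (pawalk_verts X p) \<longrightarrow>
      (\<forall>Z\<in>set (pawalk_verts X p). X \<inter> Y \<subseteq> Z))"
    unfolding clique_tree_def apath_pcas awalk_verts_with_proj_eq using True by simp
  also have "\<dots> \<longleftrightarrow> (\<forall>(A, B)\<in>parcs T. junction_edge (max_cliques G) (parcs T) A B)"
    by (rule junction_property_iff[OF R T(3)])
  finally show ?thesis unfolding junction_tree_def using 1 T(2) R by blast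
next
  case False
  then have "\<not> (pverts T = max_cliques G \<and> junction_tree (max_cliques G) (parcs T))"
    using junction_tree_undirected_tree[of T] assms by metis
  with False show ?thesis unfolding clique_tree_def by blast
qed

section \<open>Minimal separators\<close>

lemma clique_imp_max_clique:
  assumes "finite (pverts G)" and "clique G C"
  shows "\<exists>D\<in>max_cliques G. C \<subseteq> D"
proof -
  have "finite {D. clique G D}"
    by (rule finite_subset[of _ "Pow (pverts G)"]) (use assms(1) in \<open>auto simp: clique_def\<close>)
  from finite_has_maximal2[OF this, of C] obtain D where "clique G D" "C \<subseteq> D"
    "\<And>E. clique G E \<Longrightarrow> D \<subseteq> E \<Longrightarrow> D = E"
    using assms(2) by auto
  then show ?thesis by (auto simp: max_cliques_def)
qed

lemma finite_max_cliques: "finite (pverts G) \<Longrightarrow> finite (max_cliques G)"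
  by (rule finite_subset[of _ "Pow (pverts G)"]) (auto simp: max_cliques_def clique_def)

lemma clique_empty: "clique G {}"
  by (simp add: clique_def)

lemma max_cliques_nonempty: "finite (pverts G) \<Longrightarrow> max_cliques G \<noteq> {}"
  using clique_imp_max_clique[OF _ clique_empty] by blast

text \<open>Adjacency in the graph without \<open>S\<close>, which turns separation into
  unreachability. Its reflexive closure still relates each vertex of \<open>S\<close> to
  itself.\<close>

definition avoid :: "'v pair_pre_digraph \<Rightarrow> 'v set \<Rightarrow> 'v rel" where
  "avoid G S = parcs G \<inter> (- S) \<times> (- S)"

lemma sym_avoid: "pair_graph G \<Longrightarrow> sym (avoid G S)"
  by (auto simp: pair_graph_iff sym_def avoid_def)

lemma avoid_antimono: "S \<subseteq> S' \<Longrightarrow> (avoid G S')\<^sup>* \<subseteq> (avoid G S)\<^sup>*"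
  by (rule rtrancl_mono) (auto simp: avoid_def)

lemma separates_iff:
  assumes "a \<in> pverts G"
  shows "separates G S a b \<longleftrightarrow> S \<subseteq> pverts G - {a, b} \<and> (a, b) \<notin> (avoid G S)\<^sup>*"
proof (cases "S \<subseteq> pverts G - {a, b}")
  case True
  have "(\<exists>p. pre_digraph.apath (with_proj G) a p b \<and> set (pawalk_verts a p) \<inter> S = {}) \<longleftrightarrow>
      (a, b) \<in> (avoid G S)\<^sup>*" (is "?L \<longleftrightarrow> ?R")
  proof
    assume ?L
    then obtain p where p: "set p \<subseteq> parcs G" "pcas a p b" "set (pawalk_verts a p) \<inter> S = {}"
      by (auto simp: apath_pcas)
    then have "set p \<subseteq> avoid G S" using arc_in_pawalk_verts[OF p(2)] by (fastforce simp: avoid_def)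
    with p(2) show ?R by (rule pcas_rtrancl)
  next
    assume ?R
    then obtain p where p: "set p \<subseteq> avoid G S" "pcas a p b" "distinct (pawalk_verts a p)"
      using rtrancl_distinct_pawalk by metis
    then have "set (pawalk_verts a p) \<inter> S = {}"
      using True by (auto simp: set_pawalk_verts avoid_def)
    then show ?L using p assms by (auto simp: apath_pcas avoid_def)
  qed
  then show ?thesis using True by (auto simp: separates_def awalk_verts_with_proj_eq)
qed (auto simp: separates_def)

lemma edge_in_max_clique:
  assumes "pair_graph G" and "(u, v) \<in> parcs G"
  shows "\<exists>M\<in>max_cliques G. u \<in> M \<and> v \<in> M"
proof -
  have "clique G {u, v}" using assms by (auto simp: clique_def pair_graph_iff sym_def)
  with assms show ?thesis using clique_imp_max_clique[of G] by (fastforce simp: pair_graph_iff)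
qed

lemma vertex_in_max_clique:
  assumes "pair_graph G" and "u \<in> pverts G"
  shows "\<exists>M\<in>max_cliques G. u \<in> M"
proof -
  have "clique G {u}" using assms by (auto simp: clique_def)
  with assms show ?thesis using clique_imp_max_clique[of G] by (fastforce simp: pair_graph_iff)
qed

lemma max_clique_edge:
  "M \<in> max_cliques G \<Longrightarrow> u \<in> M \<Longrightarrow> v \<in> M \<Longrightarrow> u \<noteq> v \<Longrightarrow> (u, v) \<in> parcs G"
  by (auto simp: max_cliques_def clique_def)

lemma max_cliques_not_subset:
  "A \<in> max_cliques G \<Longrightarrow> B \<in> max_cliques G \<Longrightarrow> A \<noteq> B \<Longrightarrow> \<not> A \<subseteq> B"
  by (auto simp: max_cliques_def)

text \<open>Along a walk avoiding \<open>A \<inter> B\<close>, every vertex lies in a clique on the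
  side of \<open>A\<close>: a clique containing the next edge shares the vertex \<open>u\<close>
  outside \<open>A \<inter> B\<close> with such a clique, so it cannot be on the side of
  \<open>B\<close>.\<close>

lemma junction_tree_separates:
  assumes G: "pair_graph G" and T: "junction_tree (max_cliques G) R" and AB: "(A, B) \<in> R"
    and X: "X \<in> max_cliques G" "(X, A) \<in> (del_edge R A B)\<^sup>*" "a \<in> X"
    and Y: "Y \<in> max_cliques G" "(Y, B) \<in> (del_edge R A B)\<^sup>*" "b \<in> Y" "b \<notin> A \<inter> B"
  shows "(a, b) \<notin> (avoid G (A \<inter> B))\<^sup>*"
proof
  have "junction_edge (max_cliques G) R A B" using T AB by (auto simp: junction_tree_def)
  then have le: "\<And>X Y. X \<in> max_cliques G \<Longrightarrow> Y \<in> max_cliques G \<Longrightarrow> (X, A) \<in> (del_edge R A B)\<^sup>* \<Longrightarrow>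
      (Y, B) \<in> (del_edge R A B)\<^sup>* \<Longrightarrow> X \<inter> Y \<subseteq> A \<inter> B"
    unfolding junction_edge_def by blast
  assume "(a, b) \<in> (avoid G (A \<inter> B))\<^sup>*"
  then have "\<exists>X\<in>max_cliques G. (X, A) \<in> (del_edge R A B)\<^sup>* \<and> b \<in> X"
  proof induction
    case base
    then show ?case using X by blast
  next
    case (step u v)
    then have uv: "(u, v) \<in> parcs G" "u \<notin> A \<inter> B" by (auto simp: avoid_def)
    obtain M where M: "M \<in> max_cliques G" "u \<in> M" "v \<in> M"
      using edge_in_max_clique[OF G uv(1)] by blast
    obtain X where X: "X \<in> max_cliques G" "(X, A) \<in> (del_edge R A B)\<^sup>*" "u \<in> X"
      using step.IH by blast
    from junction_tree_side[OF T AB M(1)] show ?case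
    proof
      assume "(M, B) \<in> (del_edge R A B)\<^sup>*"
      with le[OF X(1) M(1) X(2)] X(3) M(2) uv(2) show ?case by blast
    qed (use M in blast)
  qed
  then obtain X where "X \<in> max_cliques G" "(X, A) \<in> (del_edge R A B)\<^sup>*" "b \<in> X" by blast
  with le[of X Y] Y show False by blast
qed

text \<open>For an edge of the tree, vertices of \<open>A - B\<close> and \<open>B - A\<close> are
  separated by \<open>A \<inter> B\<close>, and each vertex of \<open>A \<inter> B\<close> is a
  common neighbour of them, whence minimality. Conversely, some edge on the way from a clique of
  \<open>a\<close> to a clique of \<open>b\<close> carries a separator inside \<open>S\<close>, and
  minimality of \<open>S\<close> gives equality.\<close>

lemma min_separators_eq:
  assumes G: "pair_graph G" and T: "junction_tree (max_cliques G) R"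
  shows "min_separators G = (\<lambda>(A, B). A \<inter> B) ` R"
proof (intro equalityI subsetI)
  have RN: "\<And>A B. (A, B) \<in> R \<Longrightarrow> A \<in> max_cliques G \<and> B \<in> max_cliques G" and "sym R"
    and edge: "\<And>A B. (A, B) \<in> R \<Longrightarrow> junction_edge (max_cliques G) R A B"
    using T by (auto simp: junction_tree_def)
  have cl: "\<And>A. A \<in> max_cliques G \<Longrightarrow> A \<subseteq> pverts G" by (auto simp: max_cliques_def clique_def)
  {
    fix S assume "S \<in> (\<lambda>(A, B). A \<inter> B) ` R"
    then obtain A B where AB: "(A, B) \<in> R" and S: "S = A \<inter> B" by auto
    then obtain a b where a: "a \<in> A" "a \<notin> B" and b: "b \<in> B" "b \<notin> A"
      using RN[OF AB] junction_edge_neq[OF edge[OF AB]] max_cliques_not_subset[of A G B]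
        max_cliques_not_subset[of B G A] by blast
    have V: "a \<in> pverts G" "b \<in> pverts G" "S \<subseteq> pverts G" using RN[OF AB] cl a b S by auto
    have ab: "(a, b) \<notin> (avoid G S)\<^sup>*" unfolding S
      using junction_tree_separates[OF G T AB] RN[OF AB] a b by blast
    have "(a, b) \<notin> parcs G" using ab a b by (auto simp: S avoid_def)
    moreover have "separates G S a b" using V ab a b by (auto simp: separates_iff S)
    moreover have "\<not> separates G S' a b" if "S' \<subset> S" for S'
    proof -
      obtain s where s: "s \<in> A" "s \<in> B" "s \<notin> S'" using \<open>S' \<subset> S\<close> S by blast
      have "(a, s) \<in> avoid G S'" "(s, b) \<in> avoid G S'"
        using max_clique_edge[of A G a s] max_clique_edge[of B G s b] RN[OF AB] a b s that S
        by (auto simp: avoid_def)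
      then have "(a, b) \<in> (avoid G S')\<^sup>*" by auto
      then show ?thesis by (simp add: separates_iff V)
    qed
    moreover have "a \<noteq> b" using a b by auto
    ultimately show "S \<in> min_separators G" using V unfolding min_separators_def by blast
  }
  fix S assume "S \<in> min_separators G"
  then obtain a b where V: "a \<in> pverts G" "b \<in> pverts G" and S: "S \<subseteq> pverts G - {a, b}"
    and ab: "(a, b) \<notin> (avoid G S)\<^sup>*" and min: "\<And>S'. S' \<subset> S \<Longrightarrow> \<not> separates G S' a b"
    by (auto simp: min_separators_def separates_iff)
  obtain Ca Cb where Ca: "Ca \<in> max_cliques G" "a \<in> Ca" and Cb: "Cb \<in> max_cliques G" "b \<in> Cb"
    using vertex_in_max_clique[OF G] V by blast
  \<comment> \<open>\<open>U\<close> collects the cliques that meet the component of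
    \<open>a\<close> outside \<open>S\<close>; the edge sought is the last exit from
    \<open>U\<close>.\<close>
  define U where "U = {X \<in> max_cliques G. \<exists>u\<in>X - S. (a, u) \<in> (avoid G S)\<^sup>*}"
  have reach: "(a, v) \<in> (avoid G S)\<^sup>*" if X: "X \<in> U" "v \<in> X" "v \<notin> S" for X v
  proof -
    obtain u where u: "u \<in> X" "u \<notin> S" "(a, u) \<in> (avoid G S)\<^sup>*" using X by (auto simp: U_def)
    have "X \<in> max_cliques G" using X by (simp add: U_def)
    then have "u = v \<or> (u, v) \<in> avoid G S" using max_clique_edge[of X G u v] u X by (auto simp: avoid_def)
    then show ?thesis using u(3) by auto
  qed
  have "Ca \<in> U" using Ca S by (auto simp: U_def)
  moreover have "Cb \<notin> U" using reach[of Cb b] Cb S ab by auto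
  moreover have "(Ca, Cb) \<in> R\<^sup>*" using T Ca Cb by (auto simp: junction_tree_def)
  ultimately obtain A B where A: "A \<in> U" and B: "B \<notin> U" and AB: "(A, B) \<in> R"
    and path: "(B, Cb) \<in> (R \<inter> (- U) \<times> (- U))\<^sup>*"
    using rtrancl_last_exit[of Ca Cb R U] by blast
  have "R \<inter> (- U) \<times> (- U) \<subseteq> del_edge R A B" using A by (auto simp: del_edge_def)
  from rtrancl_mono[OF this] path have "(B, Cb) \<in> (del_edge R A B)\<^sup>*" by auto
  then have CbB: "(Cb, B) \<in> (del_edge R A B)\<^sup>*" using sym_rtranclD[OF sym_del_edge[OF \<open>sym R\<close>]] by blast
  have sub: "A \<inter> B \<subseteq> S"
  proof (rule ccontr)
    assume "\<not> A \<inter> B \<subseteq> S"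
    then obtain v where v: "v \<in> A" "v \<in> B" "v \<notin> S" by auto
    with reach[OF A] have "(a, v) \<in> (avoid G S)\<^sup>*" by auto
    with v B RN[OF AB] show False by (auto simp: U_def)
  qed
  \<comment> \<open>Nothing places \<open>Ca\<close> on the side of \<open>A\<close>, so
    \<open>a\<close> is represented by a vertex \<open>u\<close> of \<open>A\<close> in its
    component.\<close>
  obtain u where u: "u \<in> A" "(a, u) \<in> (avoid G S)\<^sup>*" using A by (auto simp: U_def)
  have "(u, b) \<notin> (avoid G (A \<inter> B))\<^sup>*"
    using junction_tree_separates[OF G T AB _ _ u(1) Cb(1) CbB Cb(2)] RN[OF AB] S sub by blast
  moreover have "(u, a) \<in> (avoid G (A \<inter> B))\<^sup>*"
    using u(2) avoid_antimono[OF sub] sym_rtranclD[OF sym_avoid[OF G]] by blast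
  ultimately have "(a, b) \<notin> (avoid G (A \<inter> B))\<^sup>*" by (meson rtrancl_trans)
  then have "separates G (A \<inter> B) a b" using V S sub by (auto simp: separates_iff)
  with min sub have "A \<inter> B = S" by blast
  with AB show "S \<in> (\<lambda>(A, B). A \<inter> B) ` R" by force
qed

section \<open>Simplicial vertices of chordal graphs\<close>

lemma pcas_map_upt:
  "m \<le> n \<Longrightarrow> pcas (f m) (map (\<lambda>i. (f i, f (Suc i))) [m..<n]) (f n) \<and>
     pawalk_verts (f m) (map (\<lambda>i. (f i, f (Suc i))) [m..<n]) = map f [m..<Suc n]"
proof (induction m rule: inc_induct)
  case (step m)
  then show ?case by (simp add: upt_conv_Cons)
qed simp

text \<open>A shortest walk from \<open>s\<close> to \<open>t\<close> whose inner vertices are not neighbours of \<open>x\<close>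
  closes up through \<open>x\<close> to a chordless cycle.\<close>

lemma chordal_common_neighbour:
  assumes G: "pair_graph G" and "chordal G" and xs: "(x, s) \<in> parcs G" and xt: "(x, t) \<in> parcs G"
    and walk: "(s, t) \<in> (parcs G \<inter> K \<times> K)\<^sup>*"
    and K: "\<And>v. v \<in> K \<Longrightarrow> v \<noteq> x \<and> ((x, v) \<in> parcs G \<longrightarrow> v = s \<or> v = t)"
  shows "s = t \<or> (s, t) \<in> parcs G"
proof (rule ccontr)
  assume neg: "\<not> ?thesis"
  let ?E = "parcs G" and ?Q = "parcs G \<inter> K \<times> K"
  have "sym ?E" and irr: "\<And>u. (u, u) \<notin> ?E" and EV: "?E \<subseteq> pverts G \<times> pverts G"
    using G by (auto simp: pair_graph_iff)
  \<comment> \<open>Minimality of \<open>n\<close> makes the walk \<open>f\<close> a path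
    (\<open>inj\<close>) without shortcuts (\<open>ind\<close>).\<close>
  define n where "n = (LEAST n. (s, t) \<in> ?Q ^^ n)"
  have "\<exists>n. (s, t) \<in> ?Q ^^ n" using walk by (simp add: rtrancl_power)
  then have n: "(s, t) \<in> ?Q ^^ n" unfolding n_def by (rule LeastI_ex)
  have least: "n \<le> m" if "(s, t) \<in> ?Q ^^ m" for m
    unfolding n_def using that by (rule Least_le)
  obtain f where f: "f 0 = s" "f n = t" "\<And>i. i < n \<Longrightarrow> (f i, f (Suc i)) \<in> ?Q"
    using n by (auto simp: relpow_fun_conv)
  have pow: "(f i, f j) \<in> ?Q ^^ (j - i)" if "i \<le> j" "j \<le> n" for i j
    unfolding relpow_fun_conv using that f(3) by (intro exI[of _ "\<lambda>k. f (i + k)"]) auto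
  have inj: "f i \<noteq> f j" if "i < j" "j \<le> n" for i j
  proof
    assume "f i = f j"
    then have "(s, t) \<in> ?Q ^^ (i + (n - j))"
      using pow[of 0 i] pow[of j n] that f(1,2) unfolding relpow_add by auto
    from least[OF this] that show False by simp
  qed
  have ind: "j = Suc i" if "i < j" "j \<le> n" "(f i, f j) \<in> ?Q" for i j
  proof -
    have "(s, f j) \<in> ?Q ^^ (Suc i)"
      using pow[of 0 i] that f(1) by auto
    then have "(s, t) \<in> ?Q ^^ (Suc i + (n - j))"
      using pow[of j n] that f(2) unfolding relpow_add by auto
    from least[OF this] that show ?thesis by simp
  qed
  have "n \<noteq> 0" using neg f by (metis)
  moreover have "n \<noteq> 1" using neg f(1,2) f(3)[of 0] by auto
  ultimately have "2 \<le> n" by simp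
  have fK: "f i \<in> K" if "i \<le> n" for i
    using that f(3)[of i] f(3)[of "i - 1"] \<open>2 \<le> n\<close> by (cases "i < n") auto
  define p where "p = map (\<lambda>i. (f i, f (Suc i))) [0..<n]"
  have p: "pcas s p t" "pawalk_verts s p = map f [0..<Suc n]"
    using pcas_map_upt[of 0 n f] f(1,2) by (auto simp: p_def)
  have "inj_on f {0..n}"
    by (rule linorder_inj_onI') (use inj in auto)
  then have "distinct (pawalk_verts s p)"
    by (simp add: p distinct_map atLeastLessThanSuc_atLeastAtMost del: upt_Suc)
  \<comment> \<open>The cycle has \<open>n + 2\<close> arcs, and \<open>n\<close> is at least 2
    because \<open>s\<close> and \<open>t\<close> are distinct and not adjacent.\<close>
  define c where "c = (x, s) # p @ [(t, x)]"
  have setp: "set p = (\<lambda>i. (f i, f (Suc i))) ` {..<n}" by (auto simp: p_def)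
  have cv: "pawalk_verts x c = x # map f [0..<Suc n] @ [x]"
    using p pawalk_verts_append_Cons[OF p(1), of x "[]"] by (simp add: c_def)
  have "x \<notin> f ` {0..n}" using fK K by fastforce
  then have "distinct (tl (pawalk_verts x c))"
    using \<open>distinct (pawalk_verts s p)\<close> p cv by auto
  moreover have "set c \<subseteq> ?E"
    using xs xt \<open>sym ?E\<close> f(3) by (auto simp: c_def setp sym_def)
  moreover have "pcas x c x" using p by (auto simp: c_def pcas_append)
  moreover have "x \<in> pverts G" using xs EV by auto
  ultimately have "pre_digraph.cycle (with_proj G) c" by (auto simp: cycle_pcas c_def)
  moreover have "4 \<le> length c" using \<open>2 \<le> n\<close> by (simp add: c_def p_def)
  ultimately obtain u v where uv: "u \<in> fst ` set c" "v \<in> fst ` set c" "(u, v) \<in> ?E"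
    "(u, v) \<notin> set c" "(v, u) \<notin> set c"
    using \<open>chordal G\<close> unfolding chordal_def by blast
  have "fst ` set c \<subseteq> insert x (f ` {..n})"
    using f(2) imageI[of n "{..n}" f] by (auto simp: c_def setp)
  then have fst_c: "w = x \<or> (\<exists>i\<le>n. w = f i)" if "w \<in> fst ` set c" for w
    using that by blast
  \<comment> \<open>No chord ends in \<open>x\<close>, since its only neighbours on the cycle are
    \<open>s\<close> and \<open>t\<close>. A chord between two vertices of the walk then contradicts
    \<open>ind\<close>.\<close>
  have xw: "(x, w) \<in> set c \<or> (w, x) \<in> set c" if w: "w \<in> fst ` set c" "(x, w) \<in> ?E" for w
  proof -
    have "w \<noteq> x" using w(2) irr by blast
    then have "w \<in> K" using fst_c[OF w(1)] fK by blast
    then have "w = s \<or> w = t" using K w(2) by blast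
    then show ?thesis by (auto simp: c_def)
  qed
  have "v \<noteq> x" using xw[of u] uv \<open>sym ?E\<close> by (meson symD)
  moreover have "u \<noteq> x" using xw[of v] uv by blast
  ultimately obtain i j where ij: "i \<le> n" "j \<le> n" "u = f i" "v = f j"
    using fst_c[OF uv(1)] fst_c[OF uv(2)] by blast
  have Q: "(f i, f j) \<in> ?Q" "(f j, f i) \<in> ?Q"
    using fK[OF ij(1)] fK[OF ij(2)] uv(3) symD[OF \<open>sym ?E\<close> uv(3)] ij(3,4) by auto
  have arc: "(f k, f (Suc k)) \<in> set c" if "k < n" for k
    using that by (simp add: c_def setp)
  consider "i < j" | "j < i" | "i = j" by linarith
  then show False
  proof cases
    case 1
    with ind[OF 1 ij(2) Q(1)] ij(2) arc[of i] uv(4) show False by (simp add: ij(3,4))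
  next
    case 2
    with ind[OF 2 ij(1) Q(2)] ij(1) arc[of j] uv(5) show False by (simp add: ij(3,4))
  next
    case 3
    with ij(3,4) uv(3) irr show False by simp
  qed
qed

text \<open>Taken relative to a vertex set, so that the inductions can shrink \<open>W\<close> while
  \<open>G\<close> stays fixed.\<close>

definition simplicial :: "'v pair_pre_digraph \<Rightarrow> 'v set \<Rightarrow> 'v \<Rightarrow> bool" where
  "simplicial G W z \<longleftrightarrow> (\<forall>u\<in>W. \<forall>v\<in>W. (z, u) \<in> parcs G \<longrightarrow> (z, v) \<in> parcs G \<longrightarrow> u \<noteq> v \<longrightarrow> (u, v) \<in> parcs G)"

text \<open>Dirac's theorem, strengthened for the induction: the component \<open>B\<close> of the
  non-neighbours of \<open>x\<close> is attached to a clique \<open>S\<close> of neighbours of \<open>x\<close>, and a simplicial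
  vertex of \<open>B \<union> S\<close> that lies in \<open>B\<close> is simplicial in the whole graph.\<close>

lemma chordal_simplicial_nonneighbour:
  assumes G: "pair_graph G" and ch: "chordal G"
  shows "finite W \<Longrightarrow> x \<in> W \<Longrightarrow> y \<in> W \<Longrightarrow> y \<noteq> x \<Longrightarrow> (x, y) \<notin> parcs G \<Longrightarrow>
    \<exists>z\<in>W. z \<noteq> x \<and> (x, z) \<notin> parcs G \<and> simplicial G W z"
proof (induction W arbitrary: x y rule: finite_psubset_induct)
  case (psubset W)
  let ?E = "parcs G"
  have symE: "\<And>u v. (u, v) \<in> ?E \<longleftrightarrow> (v, u) \<in> ?E" and irr: "\<And>u. (u, u) \<notin> ?E"
    using G by (auto simp: pair_graph_iff sym_def)
  define M where "M = {v \<in> W. v \<noteq> x \<and> (x, v) \<notin> ?E}"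
  define B where "B = {v. (y, v) \<in> (?E \<inter> M \<times> M)\<^sup>*}"
  define S where "S = {s \<in> W. (x, s) \<in> ?E \<and> (\<exists>b\<in>B. (s, b) \<in> ?E)}"
  have "y \<in> M" using psubset.prems by (auto simp: M_def)
  have BM: "B \<subseteq> M"
  proof
    fix v assume "v \<in> B"
    then have "(y, v) \<in> (?E \<inter> M \<times> M)\<^sup>*" by (simp add: B_def)
    then show "v \<in> M" by cases (use \<open>y \<in> M\<close> in auto)
  qed
  have Bedge: "v \<in> B" if "u \<in> B" "(u, v) \<in> ?E" "v \<in> M" for u v
    using that BM unfolding B_def by (auto intro: rtrancl_into_rtrancl)
  have Bpath: "(b, c) \<in> (?E \<inter> M \<times> M)\<^sup>*" if "b \<in> B" "c \<in> B" for b c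
  proof -
    have "sym (?E \<inter> M \<times> M)" using symE by (auto simp: sym_def)
    from sym_rtranclD[OF this] that show ?thesis unfolding B_def by (auto intro: rtrancl_trans)
  qed
  \<comment> \<open>Two vertices of \<open>S\<close> are joined through \<open>B\<close>, whose
    vertices are not neighbours of \<open>x\<close>, so \<open>chordal_common_neighbour\<close>
    applies.\<close>
  have S_clique: "(s, t) \<in> ?E" if st: "s \<in> S" "t \<in> S" "s \<noteq> t" for s t
  proof -
    let ?K = "M \<union> {s, t}"
    obtain b c where b: "b \<in> B" "(s, b) \<in> ?E" and c: "c \<in> B" "(t, c) \<in> ?E"
      using st by (auto simp: S_def)
    have "(b, c) \<in> (?E \<inter> ?K \<times> ?K)\<^sup>*"
      using Bpath[OF b(1) c(1)] rtrancl_mono[of "?E \<inter> M \<times> M" "?E \<inter> ?K \<times> ?K"] by auto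
    moreover have "(s, b) \<in> ?E \<inter> ?K \<times> ?K" "(c, t) \<in> ?E \<inter> ?K \<times> ?K"
      using b c BM symE by auto
    ultimately have "(s, t) \<in> (?E \<inter> ?K \<times> ?K)\<^sup>*"
      by (meson converse_rtrancl_into_rtrancl rtrancl_into_rtrancl)
    moreover have "(x, s) \<in> ?E" "(x, t) \<in> ?E" using st by (auto simp: S_def)
    moreover have "v \<noteq> x \<and> ((x, v) \<in> ?E \<longrightarrow> v = s \<or> v = t)" if "v \<in> ?K" for v
      using that st irr by (auto simp: M_def S_def)
    ultimately show ?thesis
      using chordal_common_neighbour[OF G ch, of x s t ?K] \<open>s \<noteq> t\<close> by blast
  qed
  let ?W = "B \<union> S"
  have sub: "?W \<subset> W" using BM irr \<open>x \<in> W\<close> by (auto simp: M_def S_def)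
  have "y \<in> B" by (simp add: B_def)
  have nbr: "w \<in> ?W" if "b \<in> B" "w \<in> W" "(b, w) \<in> ?E" for b w
  proof -
    have "w \<noteq> x" using that BM symE by (auto simp: M_def)
    then show ?thesis using that Bedge[of b w] symE by (auto simp: M_def S_def)
  qed
  have lift: ?case if z: "z \<in> B" "simplicial G ?W z" for z
  proof -
    have "simplicial G W z" using z nbr unfolding simplicial_def by blast
    then show ?thesis using z BM by (auto simp: M_def)
  qed
  \<comment> \<open>The induction hypothesis at \<open>s\<close> gives a simplicial vertex not
    adjacent to \<open>s\<close>, hence outside the clique \<open>S\<close> and therefore in
    \<open>B\<close>.\<close>
  have univ: ?case if sw: "s \<in> S" "w \<in> ?W" "w \<noteq> s" "(s, w) \<notin> ?E" for s w
  proof -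
    obtain z where "z \<in> ?W" "z \<noteq> s" "(s, z) \<notin> ?E" "simplicial G ?W z"
      using psubset.IH[OF sub, of s w] sw by auto
    then show ?thesis using lift[of z] S_clique[of s z] sw(1) by auto
  qed
  consider s w where "s \<in> S" "w \<in> ?W" "w \<noteq> s" "(s, w) \<notin> ?E"
    | b w where "b \<in> B" "w \<in> ?W" "w \<noteq> b" "(b, w) \<notin> ?E" "\<And>s. s \<in> S \<Longrightarrow> b = s \<or> (s, b) \<in> ?E"
    | "\<And>v w. v \<in> ?W \<Longrightarrow> w \<in> ?W \<Longrightarrow> v \<noteq> w \<Longrightarrow> (v, w) \<in> ?E"
    by blast
  then show ?case
  proof cases
    case 1
    then show ?thesis by (rule univ)
  next
    case 2
    then obtain z where z: "z \<in> ?W" "z \<noteq> b" "(b, z) \<notin> ?E" "simplicial G ?W z"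
      using psubset.IH[OF sub, of b w] by auto
    \<comment> \<open>Here \<open>b\<close> is adjacent to all of \<open>S\<close>, so a
      non-neighbour of \<open>b\<close> lies in \<open>B\<close>.\<close>
    have "z \<notin> S" using 2(5)[of z] z(2,3) symE[of z b] by blast
    then show ?thesis using lift[of z] z(1,4) by blast
  next
    case 3
    then have "simplicial G ?W y" unfolding simplicial_def by blast
    then show ?thesis using lift \<open>y \<in> B\<close> by blast
  qed
qed

lemma chordal_simplicial:
  assumes "pair_graph G" and "chordal G" and "finite W" and "W \<noteq> {}"
  shows "\<exists>z\<in>W. simplicial G W z"
proof (cases "\<exists>x\<in>W. \<exists>y\<in>W. y \<noteq> x \<and> (x, y) \<notin> parcs G")
  case True
  then obtain x y where "x \<in> W" "y \<in> W" "y \<noteq> x" "(x, y) \<notin> parcs G" by blast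
  from chordal_simplicial_nonneighbour[OF assms(1-3) this] show ?thesis by blast
next
  case False
  then have "\<And>u v. u \<in> W \<Longrightarrow> v \<in> W \<Longrightarrow> u \<noteq> v \<Longrightarrow> (u, v) \<in> parcs G" by metis
  then have "simplicial G W z" for z by (simp add: simplicial_def)
  then show ?thesis using \<open>W \<noteq> {}\<close> by blast
qed

section \<open>Perfect sequences\<close>

text \<open>The clique condition of \<open>perfect_sequence\<close> is left out: for lists of
  cliques it is automatic, a history separator being a subset of \<open>Cs ! k\<close>.\<close>

definition running_intersection :: "'v set list \<Rightarrow> bool" where
  "running_intersection Cs \<longleftrightarrow> (\<forall>k\<in>{1..<length Cs}. \<exists>j<k. history_sep Cs k \<subseteq> Cs ! j)"

lemma running_intersection_append:
  assumes "running_intersection Cs" and "M \<in> set Cs" and "\<Union>(set Cs) \<inter> C \<subseteq> M"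
  shows "running_intersection (Cs @ [C])"
  unfolding running_intersection_def
proof
  fix k assume k: "k \<in> {1..<length (Cs @ [C])}"
  show "\<exists>j<k. history_sep (Cs @ [C]) k \<subseteq> (Cs @ [C]) ! j"
  proof (cases "k < length Cs")
    case True
    then have eq: "history_sep (Cs @ [C]) k = history_sep Cs k"
      by (auto simp: history_sep_def nth_append)
    have "\<exists>j<k. history_sep Cs k \<subseteq> Cs ! j"
      using assms(1) True k by (auto simp: running_intersection_def)
    then obtain j where "j < k" "history_sep Cs k \<subseteq> Cs ! j" by blast
    with True show ?thesis by (intro exI[of _ j]) (auto simp: eq nth_append)
  next
    case False
    then have "k = length Cs" using k by auto
    moreover obtain j where "j < length Cs" "Cs ! j = M" using assms(2) by (auto simp: in_set_conv_nth)
    moreover have "history_sep (Cs @ [C]) (length Cs) \<subseteq> \<Union>(set Cs) \<inter> C"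
      by (auto simp: history_sep_def nth_append intro: bexI[OF _ nth_mem])
    ultimately show ?thesis using assms(3) by (intro exI[of _ j]) (auto simp: nth_append)
  qed
qed

text \<open>The new vertex \<open>z\<close> lies in a single member of the list, hence in no history
  separator.\<close>

lemma running_intersection_update:
  assumes "running_intersection Cs" and i: "i < length Cs" and z: "z \<notin> \<Union>(set Cs)"
  shows "running_intersection (Cs[i := insert z (Cs ! i)])"
  unfolding running_intersection_def
proof
  let ?Cs = "Cs[i := insert z (Cs ! i)]"
  fix k assume k: "k \<in> {1..<length ?Cs}"
  then have "\<exists>j<k. history_sep Cs k \<subseteq> Cs ! j"
    using assms(1) by (auto simp: running_intersection_def)
  then obtain j where j: "j < k" "history_sep Cs k \<subseteq> Cs ! j" by blast
  have nth: "?Cs ! l = (if l = i then insert z (Cs ! l) else Cs ! l)" if "l < length Cs" for l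
    using that i by auto
  have zl: "z \<notin> Cs ! l" if "l < length Cs" for l using z that by auto
  have "history_sep ?Cs k \<subseteq> history_sep Cs k"
  proof
    fix v assume "v \<in> history_sep ?Cs k"
    then obtain l where "l < k" "v \<in> ?Cs ! l" "v \<in> ?Cs ! k" by (auto simp: history_sep_def)
    with k zl show "v \<in> history_sep Cs k" by (auto simp: history_sep_def nth split: if_splits)
  qed
  also have "\<dots> \<subseteq> ?Cs ! j" using j k by (auto simp: nth)
  finally show "\<exists>j<k. history_sep ?Cs k \<subseteq> ?Cs ! j" using j by blast
qed

text \<open>As \<open>z\<close> is simplicial, \<open>insert z N\<close> is a clique, and it
  contains every clique through \<open>z\<close>. Among the old maximal cliques only
  \<open>N\<close> can thus lose its maximality.\<close>

lemma max_cliques_insert_simplicial: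
  assumes G: "pair_graph G" and z: "z \<notin> W" and simp: "simplicial G (insert z W) z"
  defines "N \<equiv> {u \<in> W. (z, u) \<in> parcs G}"
  shows "max_cliques \<lparr>pverts = insert z W, parcs = parcs G\<rparr> =
    insert (insert z N) (max_cliques \<lparr>pverts = W, parcs = parcs G\<rparr> - {N})" (is "max_cliques ?G' = insert ?C (max_cliques ?G - _)")
    and "clique \<lparr>pverts = W, parcs = parcs G\<rparr> N"
proof -
  have symE: "\<And>u v. (u, v) \<in> parcs G \<longleftrightarrow> (v, u) \<in> parcs G"
    using G by (auto simp: pair_graph_iff sym_def)
  show N: "clique ?G N" using simp by (auto simp: clique_def N_def simplicial_def)
  have C: "clique ?G' ?C" using N symE by (auto simp: clique_def N_def)
  have clW: "clique ?G' D \<longleftrightarrow> clique ?G D" if "z \<notin> D" for D using that by (auto simp: clique_def)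
  have clz: "D \<subseteq> ?C" if "clique ?G' D" "z \<in> D" for D using that z by (auto simp: clique_def N_def)
  have zN: "z \<notin> N" using z by (auto simp: N_def)
  have zG: "z \<notin> D" if "clique ?G D" for D using that z by (auto simp: clique_def)
  show "max_cliques ?G' = insert ?C (max_cliques ?G - {N})"
  proof (intro equalityI subsetI)
    fix D assume D: "D \<in> max_cliques ?G'"
    then have D': "clique ?G' D" "\<And>E. clique ?G' E \<Longrightarrow> \<not> D \<subset> E" by (auto simp: max_cliques_def)
    show "D \<in> insert ?C (max_cliques ?G - {N})"
    proof (cases "z \<in> D")
      case True
      with D' C clz show ?thesis by blast
    next
      case False
      have "\<not> D \<subset> E" if "clique ?G E" for E
        using D'(2)[of E] clW[of E] zG[OF that] that by blast
      moreover have "D \<noteq> N" using D'(2)[OF C] zN by blast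
      ultimately show ?thesis using D'(1) clW[OF False] by (auto simp: max_cliques_def)
    qed
  next
    fix D assume D: "D \<in> insert ?C (max_cliques ?G - {N})"
    show "D \<in> max_cliques ?G'"
    proof (cases "D = ?C")
      case True
      have "\<not> ?C \<subset> E" if "clique ?G' E" for E using clz[OF that] by blast
      then show ?thesis using C True by (auto simp: max_cliques_def)
    next
      case False
      then have D': "clique ?G D" "D \<noteq> N" "\<And>E. clique ?G E \<Longrightarrow> \<not> D \<subset> E"
        using D by (auto simp: max_cliques_def)
      have "\<not> D \<subset> E" if E: "clique ?G' E" for E
      proof (cases "z \<in> E")
        case True
        show ?thesis
        proof
          assume "D \<subset> E"
          then have "D \<subseteq> N" using clz[OF E True] zG[OF D'(1)] by blast
          then show False using D'(2,3) N by blast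
        qed
      qed (use D'(3) E clW in blast)
      then show ?thesis using D'(1) clW zG by (auto simp: max_cliques_def)
    qed
  qed
qed

text \<open>A simplicial vertex \<open>z\<close> is removed. If its neighbourhood \<open>N\<close>
  was a maximal clique, \<open>insert z N\<close> takes over its position; otherwise
  \<open>insert z N\<close> is appended and meets the earlier cliques inside a maximal clique
  containing \<open>N\<close>.\<close>

lemma chordal_running_intersection:
  assumes G: "pair_graph G" and "chordal G"
  shows "finite W \<Longrightarrow> \<exists>Cs. distinct Cs \<and> set Cs = max_cliques \<lparr>pverts = W, parcs = parcs G\<rparr> \<and>
    running_intersection Cs"
proof (induction W rule: finite_psubset_induct)
  case (psubset W)
  show ?case
  proof (cases "W = {}")
    case True
    \<comment> \<open>The empty clique is maximal in the empty graph, so the list starts with one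
      member; the first vertex then replaces it.\<close>
    have "max_cliques \<lparr>pverts = {}, parcs = parcs G\<rparr> = {{}}"
      by (auto simp: max_cliques_def clique_def)
    then show ?thesis using True
      by (intro exI[of _ "[{}]"]) (auto simp: running_intersection_def)
  next
    case False
    then obtain z where z: "z \<in> W" "simplicial G W z"
      using chordal_simplicial[OF G \<open>chordal G\<close> psubset.hyps] by blast
    define V where "V = W - {z}"
    have W: "W = insert z V" "z \<notin> V" using z by (auto simp: V_def)
    let ?G = "\<lparr>pverts = V, parcs = parcs G\<rparr>"
    define N where "N = {u \<in> V. (z, u) \<in> parcs G}"
    have mc: "max_cliques \<lparr>pverts = W, parcs = parcs G\<rparr> = insert (insert z N) (max_cliques ?G - {N})"
      and N: "clique ?G N"
      using max_cliques_insert_simplicial[OF G W(2)] z(2) unfolding W(1) N_def by auto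
    obtain Cs where Cs: "distinct Cs" "set Cs = max_cliques ?G" "running_intersection Cs"
      using psubset.IH[of V] W by auto
    have zC: "z \<notin> \<Union>(set Cs)" using W(2) by (auto simp: Cs max_cliques_def clique_def)
    show ?thesis
    proof (cases "N \<in> set Cs")
      case True
      then obtain i where i: "i < length Cs" "Cs ! i = N" by (auto simp: in_set_conv_nth)
      have "insert z N \<notin> set Cs" using zC by auto
      moreover have "set (Cs[i := insert z N]) = insert (insert z N) (set Cs - {N})"
        using set_update_distinct[OF Cs(1) i(1)] i(2) by simp
      ultimately show ?thesis
        using running_intersection_update[OF Cs(3) i(1) zC] Cs i mc
        by (intro exI[of _ "Cs[i := insert z N]"]) (auto intro!: distinct_list_update)
    next
      case False
      obtain M where M: "M \<in> max_cliques ?G" "N \<subseteq> M"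
        using clique_imp_max_clique[OF _ N] psubset.hyps W by auto
      have "\<Union>(set Cs) \<inter> insert z N \<subseteq> M" using zC M by blast
      moreover have "insert z N \<notin> set Cs" using zC by auto
      ultimately show ?thesis
        using running_intersection_append[OF Cs(3), of M "insert z N"] False M Cs mc
        by (intro exI[of _ "Cs @ [insert z N]"]) auto
    qed
  qed
qed

lemma chordal_perfect_sequence:
  assumes G: "pair_graph G" and "chordal G"
  shows "\<exists>Cs. perfect_sequence G Cs"
proof -
  have "finite (pverts G)" using G by (simp add: pair_graph_iff)
  then obtain Cs where Cs: "distinct Cs" "set Cs = max_cliques G" "running_intersection Cs"
    using chordal_running_intersection[OF assms, of "pverts G"] by (cases G) auto
  have "clique G (history_sep Cs k)" if "k < length Cs" for k
  proof -
    have "clique G (Cs ! k)" using that Cs(2) nth_mem[OF that] by (auto simp: max_cliques_def)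
    then show ?thesis by (auto simp: clique_def history_sep_def)
  qed
  then show ?thesis using Cs by (auto simp: perfect_sequence_def running_intersection_def)
qed

section \<open>Junction trees grown along a perfect sequence\<close>

definition parent_edges :: "'v set list \<Rightarrow> (nat \<Rightarrow> nat) \<Rightarrow> nat \<Rightarrow> 'v set rel" where
  "parent_edges Cs par n = (\<Union>k\<in>{1..<n}. {(Cs ! par k, Cs ! k), (Cs ! k, Cs ! par k)})"

lemma running_intersection_junction_tree:
  assumes "distinct Cs" and "Cs \<noteq> []"
    and par: "\<And>k. k \<in> {1..<length Cs} \<Longrightarrow> par k < k \<and> history_sep Cs k \<subseteq> Cs ! par k"
  shows "junction_tree (set Cs) (parent_edges Cs par (length Cs))"
proof -
  have "junction_tree (set (take n Cs)) (parent_edges Cs par n)" if "1 \<le> n" "n \<le> length Cs" for n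
    using that
  proof (induction n rule: dec_induct)
    case base
    have "take 1 Cs = [Cs ! 0]" using \<open>Cs \<noteq> []\<close> by (cases Cs) auto
    then show ?case using junction_tree_singleton by (simp add: parent_edges_def)
  next
    case (step n)
    then have n: "n < length Cs" "1 \<le> n" by auto
    have T: "junction_tree (set (take n Cs)) (parent_edges Cs par n)" using step by auto
    have p: "par n < n" "history_sep Cs n \<subseteq> Cs ! par n" using par n by auto
    have "Cs ! n \<notin> set (take n Cs)"
      using \<open>distinct Cs\<close> n by (auto simp: in_set_conv_nth nth_eq_iff_index_eq)
    moreover have "Cs ! par n \<in> set (take n Cs)"
      using n p(1) by (auto simp: in_set_conv_nth)
    moreover have "\<Union>(set (take n Cs)) \<inter> Cs ! n \<subseteq> Cs ! par n"
      using p(2) n by (fastforce simp: history_sep_def in_set_conv_nth)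
    ultimately have "junction_tree (insert (Cs ! n) (set (take n Cs)))
        (parent_edges Cs par n \<union> {(Cs ! par n, Cs ! n), (Cs ! n, Cs ! par n)})"
      by (rule junction_tree_add_leaf[OF T])
    moreover have "{1..<Suc n} = insert n {1..<n}" using n by auto
    then have "parent_edges Cs par (Suc n) =
        parent_edges Cs par n \<union> {(Cs ! par n, Cs ! n), (Cs ! n, Cs ! par n)}"
      by (auto simp: parent_edges_def)
    moreover have "set (take (Suc n) Cs) = insert (Cs ! n) (set (take n Cs))"
      using n by (simp add: take_Suc_conv_app_nth)
    ultimately show ?case by simp
  qed
  from this[of "length Cs"] show ?thesis using \<open>Cs \<noteq> []\<close> by (cases Cs) auto
qed

lemma perfect_sequence_junction_tree:
  assumes "pair_graph G" and Cs: "perfect_sequence G Cs"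
  shows "\<exists>par. (\<forall>k\<in>{1..<length Cs}. par k < k \<and> history_sep Cs k = Cs ! par k \<inter> Cs ! k) \<and>
    junction_tree (max_cliques G) (parent_edges Cs par (length Cs))"
proof -
  have "\<forall>k\<in>{1..<length Cs}. \<exists>j<k. history_sep Cs k \<subseteq> Cs ! j"
    using Cs by (simp add: perfect_sequence_def)
  then obtain par where par: "\<And>k. k \<in> {1..<length Cs} \<Longrightarrow> par k < k \<and> history_sep Cs k \<subseteq> Cs ! par k"
    by metis
  have "finite (pverts G)" using assms(1) by (simp add: pair_graph_iff)
  then have "distinct Cs" "Cs \<noteq> []" "set Cs = max_cliques G"
    using Cs max_cliques_nonempty[of G] by (auto simp: perfect_sequence_def)
  with running_intersection_junction_tree[OF _ _ par]
  have "junction_tree (max_cliques G) (parent_edges Cs par (length Cs))" by simp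
  \<comment> \<open>One inclusion is the choice of \<open>par k\<close>; the other holds because
    \<open>par k < k\<close> puts \<open>Cs ! par k\<close> into the history.\<close>
  moreover have "history_sep Cs k = Cs ! par k \<inter> Cs ! k" if "k \<in> {1..<length Cs}" for k
    using par[OF that] by (auto simp: history_sep_def)
  ultimately show ?thesis using par by blast
qed

lemma perfect_sequence_min_separators:
  assumes "pair_graph G" and "perfect_sequence G Cs"
  shows "min_separators G = history_sep Cs ` {1..<length Cs}"
proof -
  obtain par where par: "\<And>k. k \<in> {1..<length Cs} \<Longrightarrow> history_sep Cs k = Cs ! par k \<inter> Cs ! k"
    and T: "junction_tree (max_cliques G) (parent_edges Cs par (length Cs))"
    using perfect_sequence_junction_tree[OF assms] by blast
  have "(\<lambda>(A, B). A \<inter> B) ` parent_edges Cs par (length Cs) = history_sep Cs ` {1..<length Cs}"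
    using par by (auto simp: parent_edges_def image_UN Int_commute)
  then show ?thesis using min_separators_eq[OF assms(1) T] by simp
qed

text \<open>The minimal separators are the image of an index set with \<open>length Cs - 1\<close>
  elements, so the count is attained exactly when no separator is repeated.\<close>

lemma card_min_separators_iff:
  assumes "pair_graph G" and Cs: "perfect_sequence G Cs"
  shows "card (min_separators G) = card (max_cliques G) - 1 \<longleftrightarrow> inj_on (history_sep Cs) {1..<length Cs}"
proof -
  have "card (max_cliques G) = length Cs"
    using Cs distinct_card[of Cs] by (auto simp: perfect_sequence_def)
  then show ?thesis
    unfolding perfect_sequence_min_separators[OF assms] inj_on_iff_eq_card[OF finite_atLeastLessThan]
    by simp
qed

lemma sep_multiplicity_eq_1_iff:
  "(\<forall>S\<in>history_sep Cs ` {1..<length Cs}. sep_multiplicity Cs S = 1) \<longleftrightarrow>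
    inj_on (history_sep Cs) {1..<length Cs}"
proof
  assume L: "\<forall>S\<in>history_sep Cs ` {1..<length Cs}. sep_multiplicity Cs S = 1"
  show "inj_on (history_sep Cs) {1..<length Cs}"
  proof
    fix k l assume kl: "k \<in> {1..<length Cs}" "l \<in> {1..<length Cs}" "history_sep Cs k = history_sep Cs l"
    with L have "card {i \<in> {1..<length Cs}. history_sep Cs i = history_sep Cs k} = 1"
      by (simp add: sep_multiplicity_def)
    then obtain i where "{i \<in> {1..<length Cs}. history_sep Cs i = history_sep Cs k} = {i}"
      by (rule card_1_singletonE)
    with kl show "k = l" by (metis (mono_tags, lifting) mem_Collect_eq singletonD)
  qed
next
  assume R: "inj_on (history_sep Cs) {1..<length Cs}"
  show "\<forall>S\<in>history_sep Cs ` {1..<length Cs}. sep_multiplicity Cs S = 1"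
  proof (clarify)
    fix k assume k: "k \<in> {1..<length Cs}"
    then have "{i \<in> {1..<length Cs}. history_sep Cs i = history_sep Cs k} = {k}"
      using R by (auto dest: inj_onD)
    then show "sep_multiplicity Cs (history_sep Cs k) = 1" by (simp add: sep_multiplicity_def)
  qed
qed

text \<open>Both directions compare an arbitrary junction tree with the tree \<open>R\<close> grown
  along \<open>Cs\<close>, whose edges are indexed by the positions \<open>k\<close>.\<close>

lemma unique_clique_tree_iff:
  assumes G: "pair_graph G" and Cs: "perfect_sequence G Cs"
  shows "(\<exists>!T. clique_tree G T) \<longleftrightarrow> inj_on (history_sep Cs) {1..<length Cs} \<and>
    \<not> (\<exists>S\<in>min_separators G. \<exists>S'\<in>min_separators G. S \<subset> S')"
proof -
  let ?K = "{1..<length Cs}"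
  obtain par where par: "\<And>k. k \<in> ?K \<Longrightarrow> par k < k \<and> history_sep Cs k = Cs ! par k \<inter> Cs ! k"
    and T: "junction_tree (max_cliques G) (parent_edges Cs par (length Cs))"
    using perfect_sequence_junction_tree[OF assms] by blast
  define R where "R = parent_edges Cs par (length Cs)"
  have R: "(Cs ! par k, Cs ! k) \<in> R" if "k \<in> ?K" for k using that by (auto simp: R_def parent_edges_def)
  have RE: "\<exists>k\<in>?K. A \<inter> B = history_sep Cs k \<and> {A, B} = {Cs ! par k, Cs ! k}" if AB: "(A, B) \<in> R" for A B
  proof -
    obtain k where k: "k \<in> ?K" "A = Cs ! par k \<and> B = Cs ! k \<or> A = Cs ! k \<and> B = Cs ! par k"
      using AB unfolding R_def parent_edges_def by blast
    then have "A \<inter> B = Cs ! par k \<inter> Cs ! k" "{A, B} = {Cs ! par k, Cs ! k}" by blast+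
    with k(1) par[OF k(1)] show ?thesis by metis
  qed
  have T: "junction_tree (max_cliques G) R" using T by (simp add: R_def)
  have fin: "finite (pverts G)" using G by (simp add: pair_graph_iff)
  note ct = clique_tree_iff[OF finite_max_cliques[OF fin] max_cliques_nonempty[OF fin]]
  have unique: "(\<exists>!T. clique_tree G T) \<longleftrightarrow> (\<forall>R'. junction_tree (max_cliques G) R' \<longrightarrow> R' = R)" (is "?L \<longleftrightarrow> ?U")
  proof
    assume ?L
    show ?U
    proof (intro allI impI)
      fix R' assume "junction_tree (max_cliques G) R'"
      then have "clique_tree G \<lparr>pverts = max_cliques G, parcs = R'\<rparr>"
        "clique_tree G \<lparr>pverts = max_cliques G, parcs = R\<rparr>"
        using T by (simp_all add: ct)
      with \<open>?L\<close> have "\<lparr>pverts = max_cliques G, parcs = R'\<rparr> = \<lparr>pverts = max_cliques G, parcs = R\<rparr>"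
        by blast
      then show "R' = R" by simp
    qed
  next
    assume ?U
    show ?L
    proof
      show "clique_tree G \<lparr>pverts = max_cliques G, parcs = R\<rparr>" using T by (simp add: ct)
      show "T' = \<lparr>pverts = max_cliques G, parcs = R\<rparr>" if "clique_tree G T'" for T'
        using that \<open>?U\<close> by (simp add: ct)
    qed
  qed
  have ms: "min_separators G = history_sep Cs ` ?K" by (rule perfect_sequence_min_separators[OF assms])
  show ?thesis unfolding unique
  proof
    assume U: "\<forall>R'. junction_tree (max_cliques G) R' \<longrightarrow> R' = R"
    \<comment> \<open>Equal separators and proper inclusions are excluded together: the first case
      yields injectivity, the second the antichain condition.\<close>
    have eq: "k = l" if kl: "k \<in> ?K" "l \<in> ?K" "history_sep Cs k \<subseteq> history_sep Cs l" for k l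
    proof (rule ccontr)
      assume "k \<noteq> l"
      have "distinct Cs" using Cs by (simp add: perfect_sequence_def)
      \<comment> \<open>Since \<open>par k < k\<close>, the index \<open>k\<close> is the larger end
        of its edge, so different indices give different edges.\<close>
      then have "{Cs ! par k, Cs ! k} \<noteq> {Cs ! par l, Cs ! l}"
        using kl \<open>k \<noteq> l\<close> par[of k] par[of l] by (auto simp: doubleton_eq_iff nth_eq_iff_index_eq)
      moreover have "Cs ! par k \<inter> Cs ! k \<subseteq> Cs ! par l \<inter> Cs ! l" using kl par by metis
      ultimately show False
        using junction_tree_not_unique[OF T R[OF kl(1)] R[OF kl(2)]] U by blast
    qed
    show "inj_on (history_sep Cs) ?K \<and> \<not> (\<exists>S\<in>min_separators G. \<exists>S'\<in>min_separators G. S \<subset> S')"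
    proof
      show "inj_on (history_sep Cs) ?K" by (rule inj_onI) (simp add: eq)
      show "\<not> (\<exists>S\<in>min_separators G. \<exists>S'\<in>min_separators G. S \<subset> S')"
      proof (intro notI, elim bexE)
        fix S S' assume "S \<in> min_separators G" "S' \<in> min_separators G" "S \<subset> S'"
        then obtain k l where "k \<in> ?K" "l \<in> ?K" "history_sep Cs k \<subset> history_sep Cs l"
          unfolding ms by blast
        with eq[of k l] show False by auto
      qed
    qed
  next
    assume inj: "inj_on (history_sep Cs) ?K \<and> \<not> (\<exists>S\<in>min_separators G. \<exists>S'\<in>min_separators G. S \<subset> S')"
    show "\<forall>R'. junction_tree (max_cliques G) R' \<longrightarrow> R' = R"
    proof (intro allI impI)
      fix R' assume T': "junction_tree (max_cliques G) R'"
      show "R' = R"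
      proof (rule junction_tree_unique[OF T T', of "min_separators G"])
        show "A \<inter> B \<in> min_separators G" if "(A, B) \<in> R \<union> R'" for A B
        proof (cases "(A, B) \<in> R")
          case True
          show ?thesis unfolding min_separators_eq[OF G T] by (rule image_eqI[OF _ True]) simp
        next
          case False
          with that have AB: "(A, B) \<in> R'" by blast
          show ?thesis unfolding min_separators_eq[OF G T'] by (rule image_eqI[OF _ AB]) simp
        qed
        show "{A, B} = {C, D}" if AB: "(A, B) \<in> R" "(C, D) \<in> R" "A \<inter> B = C \<inter> D" for A B C D
        proof -
          obtain k where k: "k \<in> ?K" "A \<inter> B = history_sep Cs k" "{A, B} = {Cs ! par k, Cs ! k}"
            using RE[OF AB(1)] by (elim bexE conjE)
          obtain l where l: "l \<in> ?K" "C \<inter> D = history_sep Cs l" "{C, D} = {Cs ! par l, Cs ! l}"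
            using RE[OF AB(2)] by (elim bexE conjE)
          have "history_sep Cs k = history_sep Cs l" using AB(3) k(2) l(2) by metis
          with conjunct1[OF inj] have "k = l" using k(1) l(1) by (rule inj_onD)
          with k(3) l(3) show ?thesis by metis
        qed
        show "\<not> S \<subset> S'" if "S \<in> min_separators G" "S' \<in> min_separators G" for S S'
          using conjunct2[OF inj] that by blast
      qed
    qed
  qed
qed

theorem theorem5p2:
  fixes G :: "'v pair_pre_digraph"
  assumes "pair_graph G" and "connected (with_proj G)" and "chordal G"
  shows "((\<exists>!T. clique_tree G T) \<longleftrightarrow>
            card (min_separators G) = card (max_cliques G) - 1 \<and>
            \<not> (\<exists>S \<in> min_separators G. \<exists>S' \<in> min_separators G. S \<subset> S')) \<and>
         (\<forall>Cs. perfect_sequence G Cs \<longrightarrow>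
            (card (min_separators G) = card (max_cliques G) - 1 \<longleftrightarrow>
             (\<forall>S \<in> min_separators G. sep_multiplicity Cs S = 1)))"
proof (intro conjI allI impI)
  \<comment> \<open>Chordality enters here, through the existence of a perfect sequence.\<close>
  obtain Cs where Cs: "perfect_sequence G Cs"
    using chordal_perfect_sequence[OF assms(1,3)] by blast
  show "(\<exists>!T. clique_tree G T) \<longleftrightarrow>
      card (min_separators G) = card (max_cliques G) - 1 \<and>
      \<not> (\<exists>S \<in> min_separators G. \<exists>S' \<in> min_separators G. S \<subset> S')"
    unfolding unique_clique_tree_iff[OF assms(1) Cs] card_min_separators_iff[OF assms(1) Cs] ..
next
  fix Cs assume Cs: "perfect_sequence G Cs"
  show "card (min_separators G) = card (max_cliques G) - 1 \<longleftrightarrow>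
      (\<forall>S \<in> min_separators G. sep_multiplicity Cs S = 1)"
    unfolding card_min_separators_iff[OF assms(1) Cs]
    unfolding perfect_sequence_min_separators[OF assms(1) Cs] sep_multiplicity_eq_1_iff ..
qed

end
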